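(* Let $U\subseteq\mathbb{R}^m$ be a nonempty closed convex set, let $F:U\to\mathbb{R}^m$ with $F(u)=\mathbb{E}[\Phi(u,\xi)]$ for all $u\in U$, and assume that the solution set $U^*$ of the variational inequality VI$(U,F)$ is nonempty and closed. Assume that: (i) for some $\sigma>0$ and all $k\ge 0$, $\mathbb{E}[\Phi(h_k,\xi_k)-F(h_k)\mid h_k]=0$ and $\mathbb{E}[\|\Phi(h_k,\xi_k)-F(h_k)\|^2\mid h_k]\le\sigma^2$; (ii) $F$ has linear growth on $U$: there exist $C\ge 0$, $D\ge 0$ such that $\|F(u)\|\le C\|u\|+D$ for all $u\in U$; (iii) $F$ is $p$-quasi sharp over $U$ relative to $U^*$: for some $p>0$ and $\mu>0$, $\langle F(u),u-u^*\rangle\ge\mu\,\mathrm{dist}^p(u,U^* )$ for all $u\in U$ and all $u^*\in U^*$; (iv) the stepsizes satisfy $\alpha_k>0$ for all $k$, $\sum_{k=0}^\infty\alpha_k=\infty$, and $\sum_{k=0}^\infty\alpha_k^2<\infty$. Then the following hold for the iterate sequences $\{u_k\}$ and $\{h_k\}$ generated by the stochastic Popov method: (a) The sequences $\{u_k\}$ and $\{h_k\}$ converge almost surely to some (random) $\bar u\in U$, where $\bar u$ is a solution almost surely, i.e., $\mathrm{Prob}(\bar u\in U^* )=1$. (b) The sequences $\{\mathbb{E}[\|u_k\|^2]\}$ and $\{\mathbb{E}[\|h_k\|^2]\}$ are bounded. (c) If the solution set $U^*$ is bounded, then the sequences $\{u_k\}$ and $\{h_k\}$ also converge in expectation, i.e.,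 $\lim_{k\to\infty}\mathbb{E}[\|u_k-\bar u\|^2]=0$ and $\lim_{k\to\infty}\mathbb{E}[\|h_k-\bar u\|^2]=0$.
   Context: The variational inequality VI$(U,F)$ is the problem of finding $u^*\in U$ with $\langle F(u^* ),u-u^*\rangle\ge 0$ for all $u\in U$; $U^*$ is the set of all such $u^*$. $\|\cdot\|$ is the Euclidean norm, $P_U(u)=\arg\min_{v\in U}\|v-u\|$ is the projection onto $U$, $\mathrm{dist}(u,Y)=\inf_{y\in Y}\|u-y\|$, and $\mathrm{dist}^p(u,Y)=(\mathrm{dist}(u,Y))^p$. Here $\Phi:U\times\mathbb{R}^d\to\mathbb{R}^m$ is a stochastic operator and $\xi$ is a $d$-dimensional random vector. Stochastic Popov method: given arbitrary deterministic points $u_0,h_0\in U$ and stepsizes $\alpha_k>0$, at each iteration $k\ge 0$, having $h_k$, a random sample $\xi_k$ is drawn according to the distribution of $\xi$, and $$u_{k+1}=P_U(u_k-\alpha_k\Phi(h_k,\xi_k)),\qquad h_{k+1}=P_U(u_{k+1}-\alpha_{k+1}\Phi(h_k,\xi_k)).$$ *)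

theory Defs
  imports "HOL-Probability.Probability"
begin

definition vi_solutions :: "'a::euclidean_space set \<Rightarrow> ('a \<Rightarrow> 'a) \<Rightarrow> 'a set" where
  "vi_solutions U F = {w \<in> U. \<forall>v\<in>U. F w \<bullet> (v - w) \<ge> 0}"

definition quasi_sharp ::
  "real \<Rightarrow> real \<Rightarrow> 'a::euclidean_space set \<Rightarrow> 'a set \<Rightarrow> ('a \<Rightarrow> 'a) \<Rightarrow> bool" where
  "quasi_sharp p \<mu> U S F \<longleftrightarrow>
     (\<forall>v\<in>U. \<forall>w\<in>S. F v \<bullet> (v - w) \<ge> \<mu> * infdist v S powr p)"

(* One sample path of the stochastic Popov method: x is the realised sequence of samples.
   For nonempty closed convex U, closest_point U is the Euclidean projection onto U. *)
definition popov_path ::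
  "'a::euclidean_space set \<Rightarrow> ('a \<Rightarrow> 'b \<Rightarrow> 'a) \<Rightarrow> (nat \<Rightarrow> real) \<Rightarrow> 'a \<Rightarrow> 'a
    \<Rightarrow> (nat \<Rightarrow> 'b) \<Rightarrow> (nat \<Rightarrow> 'a) \<Rightarrow> (nat \<Rightarrow> 'a) \<Rightarrow> bool" where
  "popov_path U \<Phi> \<alpha> u0 h0 x u h \<longleftrightarrow>
     u 0 = u0 \<and> h 0 = h0 \<and>
     (\<forall>k. u (Suc k) = closest_point U (u k - \<alpha> k *\<^sub>R \<Phi> (h k) (x k)) \<and>
          h (Suc k) = closest_point U (u (Suc k) - \<alpha> (Suc k) *\<^sub>R \<Phi> (h k) (x k)))"

(* Conditional expectation of a vector-valued random variable, taken coordinatewise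
   because real_cond_exp is only available for real-valued functions. Like real_cond_exp,
   it is meaningful only for integrable X. *)
definition vec_cond_exp ::
  "'w measure \<Rightarrow> 'w measure \<Rightarrow> ('w \<Rightarrow> 'a::euclidean_space) \<Rightarrow> 'w \<Rightarrow> 'a" where
  "vec_cond_exp M G X \<omega> = (\<Sum>b\<in>Basis. real_cond_exp M G (\<lambda>\<omega>'. X \<omega>' \<bullet> b) \<omega> *\<^sub>R b)"

(* The sigma-algebra generated by X, used to condition on X. *)
definition sigma_of :: "'w measure \<Rightarrow> ('w \<Rightarrow> 'a::topological_space) \<Rightarrow> 'w measure" where
  "sigma_of M X = vimage_algebra (space M) X borel"

end

theory Submission
  imports Defs
begin

text \<open>
  For every solution \<open>y\<close>, nonexpansiveness of the projection gives
  \<open>|u\<^bsub>k+1\<^esub> - y|\<^sup>2 \<le> |u\<^bsub>k\<^esub> - y|\<^sup>2 - 2 \<alpha>\<^bsub>k\<^esub> \<mu> dist\<^sup>p(h\<^bsub>k\<^esub>, S) + X\<^bsub>k\<^esub> + r\<^bsub>k\<^esub>\<close>, where \<open>X\<^bsub>k\<^esub>\<close> is a martingale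
  increment and \<open>r\<^bsub>k\<^esub> \<ge> 0\<close> is of order \<open>\<alpha>\<^bsub>k\<^esub>\<^sup>2\<close>, because \<open>u\<^bsub>k\<^esub> - h\<^bsub>k\<^esub>\<close> is of order \<open>\<alpha>\<^bsub>k\<^esub>\<close>. Linear growth turns this
  into a recursion for second moments with summable growth rates, so all second moments are
  bounded. Then \<open>\<Sum> r\<^bsub>k\<^esub>\<close> converges almost surely, and so does the square-integrable martingale
  \<open>\<Sum> X\<^bsub>k\<^esub>\<close> by Kolmogorov's maximal inequality. Hence almost surely \<open>|u\<^bsub>k\<^esub> - y|\<close> converges for all
  \<open>y\<close> in a countable dense set of solutions and \<open>dist(h\<^bsub>k\<^esub>, S)\<close> has lower limit \<open>0\<close>, which forces
  convergence to a solution.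
\<close>

section \<open>Projection steps and descent inequalities\<close>

text \<open>The obstacle is that the direction used at step \<open>k\<close> is sampled at
  \<open>h k\<close>, while the projection step starts from \<open>u k\<close>. Sharpness and noise
  are therefore paired with \<open>h k - y\<close>, and the mismatch \<open>u k - h k\<close> is
  paid for by the previous direction. The moment of each new direction then involves that of the one
  before, so the recursion has to run on a potential that carries the weighted moment of the
  previous direction along. The noise enters in two ways. As a martingale increment it must be
  orthogonal to everything determined by the first \<open>k\<close> samples; this comes from
  independence and Fubini with the past frozen. In squared form it occurs only with the weights 1
  and |h k - y|^2, which are functions of \<open>h k\<close>, so a variance bound conditional on
  \<open>h k\<close> alone is enough. The variance of the martingale increment contains the second
  moment of \<open>h k - y\<close>. Hence the moment bounds have to precede every pathwise
  statement.\<close>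

lemma closest_point_step_le:
  fixes x y :: "'a::euclidean_space"
  assumes "closed U" "convex U" "y \<in> U"
  shows "norm (closest_point U (x - v) - y) \<le> norm (x - v - y)"
proof -
  have "dist (closest_point U (x - v)) (closest_point U y) \<le> dist (x - v) y"
    by (rule closest_point_lipschitz) (use assms in auto)
  then show ?thesis
    using assms by (simp add: closest_point_self dist_norm)
qed

text \<open>After expanding the square, \<open>q \<bullet> (u - y)\<close> splits into a drift part,
  a noise part, both against \<open>h - y\<close>, and the mismatch
  \<open>q \<bullet> (u - h)\<close>. Cauchy-Schwarz and 2st \<le> s^2 + t^2 make the mismatch of
  order \<alpha>^2; together with the square of the step itself this produces the factor 2 before
  |q|^2.\<close>

lemma popov_descent:
  fixes u h q g y :: "'a::euclidean_space"
  assumes U: "closed U" "convex U" "y \<in> U"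
    and gap: "norm (u - h) \<le> \<alpha> * b" and "\<alpha> \<ge> 0"
  shows "(norm (closest_point U (u - \<alpha> *\<^sub>R q) - y))\<^sup>2 \<le>
    (norm (u - y))\<^sup>2 - 2 * \<alpha> * (g \<bullet> (h - y)) - 2 * \<alpha> * ((q - g) \<bullet> (h - y))
      + \<alpha>\<^sup>2 * (2 * (norm q)\<^sup>2 + b\<^sup>2)"
proof -
  have "(norm (closest_point U (u - \<alpha> *\<^sub>R q) - y))\<^sup>2 \<le> (norm (u - \<alpha> *\<^sub>R q - y))\<^sup>2"
    by (intro power_mono closest_point_step_le U norm_ge_zero)
  also have "\<dots> = (norm (u - y))\<^sup>2 - 2 * \<alpha> * (q \<bullet> (u - y)) + \<alpha>\<^sup>2 * (norm q)\<^sup>2"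
    unfolding power2_norm_eq_inner
    by (simp add: inner_diff_left inner_diff_right inner_commute algebra_simps power2_eq_square)
  also have "q \<bullet> (u - y) = g \<bullet> (h - y) + (q - g) \<bullet> (h - y) + q \<bullet> (u - h)"
    by (simp add: inner_diff_left inner_diff_right)
  finally have 1: "(norm (closest_point U (u - \<alpha> *\<^sub>R q) - y))\<^sup>2 \<le> (norm (u - y))\<^sup>2
      - 2 * \<alpha> * (g \<bullet> (h - y)) - 2 * \<alpha> * ((q - g) \<bullet> (h - y)) + \<alpha>\<^sup>2 * (norm q)\<^sup>2
      - 2 * \<alpha> * (q \<bullet> (u - h))"
    by (simp add: algebra_simps)
  have "- (q \<bullet> (u - h)) \<le> norm q * norm (u - h)"
    using Cauchy_Schwarz_ineq2[of q "u - h"] by linarith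
  also have "\<dots> \<le> norm q * (\<alpha> * b)"
    by (intro mult_left_mono gap norm_ge_zero)
  finally have "2 * \<alpha> * (- (q \<bullet> (u - h))) \<le> 2 * \<alpha> * (norm q * (\<alpha> * b))"
    using \<open>\<alpha> \<ge> 0\<close> by (intro mult_left_mono) auto
  also have "\<dots> = \<alpha>\<^sup>2 * (2 * norm q * b)"
    by (simp add: power2_eq_square)
  also have "\<dots> \<le> \<alpha>\<^sup>2 * ((norm q)\<^sup>2 + b\<^sup>2)"
    using sum_squares_bound[of "norm q" b] by (intro mult_left_mono) auto
  finally show ?thesis using 1 by (simp add: algebra_simps)
qed

section \<open>Deterministic sequences: growth, descent and Opial's argument\<close>

lemma bounded_of_summable_growth:
  fixes v \<delta> :: "nat \<Rightarrow> real"
  assumes \<delta>: "\<And>k. \<delta> k \<ge> 0" "summable \<delta>"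
    and v: "\<And>k. v k \<ge> 0" "\<And>k. v (Suc k) \<le> v k + \<delta> k * (1 + v k)"
  shows "1 + v n \<le> (1 + v 0) * exp (suminf \<delta>)"
proof -
  have "1 + v n \<le> (1 + v 0) * exp (\<Sum>k<n. \<delta> k)"
  proof (induction n)
    case (Suc n)
    \<comment> \<open>Discrete Gronwall: the shifted quantity \<open>1 + v n\<close> grows by a
      factor of at most \<open>1 + \<delta> n\<close>, which is at most
      \<open>exp (\<delta> n)\<close>.\<close>
    have "1 + v (Suc n) \<le> (1 + v n) * (1 + \<delta> n)"
      using v(2)[of n] by (simp add: algebra_simps)
    also have "\<dots> \<le> ((1 + v 0) * exp (\<Sum>k<n. \<delta> k)) * exp (\<delta> n)"
      using Suc v(1) \<delta>(1) exp_ge_add_one_self[of "\<delta> n"]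
      by (intro mult_mono) (auto simp: add_nonneg_nonneg)
    finally show ?case by (simp add: exp_add mult.assoc)
  qed simp
  also have "\<dots> \<le> (1 + v 0) * exp (suminf \<delta>)"
    using v(1)[of 0] \<delta> by (intro mult_left_mono) (auto intro!: sum_le_suminf)
  finally show ?thesis .
qed

text \<open>A pathwise counterpart of the Robbins-Siegmund lemma. The perturbation \<open>c\<close>
  may change sign and its series need only converge, as will be the case for martingale increments.
  Adding the accumulated \<open>d\<close> to \<open>a\<close> and subtracting the accumulated
  \<open>c\<close> gives a decreasing sequence that is bounded below.\<close>

lemma descent_convergent:
  fixes a c d :: "nat \<Rightarrow> real"
  assumes a: "\<And>k. a k \<ge> 0" and d: "\<And>k. d k \<ge> 0" and c: "summable c"
    and step: "\<And>k. a (Suc k) \<le> a k - d k + c k"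
  shows "convergent a" "summable d"
proof -
  define z where "z n = a n + (\<Sum>k<n. d k) - (\<Sum>k<n. c k)" for n
  have c_conv: "convergent (\<lambda>n. \<Sum>k<n. c k)"
    using c by (simp add: summable_iff_convergent)
  then have "Bseq (\<lambda>n. \<Sum>k<n. c k)" by (rule convergent_imp_Bseq)
  then obtain K where K: "\<And>n. \<bar>\<Sum>k<n. c k\<bar> \<le> K"
    unfolding Bseq_def by auto
  have "decseq z"
    using step by (intro decseq_SucI) (simp add: z_def algebra_simps)
  moreover have "- K \<le> z n" for n
    using a[of n] sum_nonneg[of "{..<n}" d] d K[of n] by (simp add: z_def)
  ultimately obtain l where "z \<longlonglongrightarrow> l"
    using decseq_convergent[of z "- K"] by blast
  then have "convergent z" by (rule convergentI)
  from convergent_add[OF this c_conv]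
  have conv: "convergent (\<lambda>n. a n + (\<Sum>k<n. d k))"
    by (simp add: z_def)
  then have "Bseq (\<lambda>n. a n + (\<Sum>k<n. d k))" by (rule convergent_imp_Bseq)
  then obtain L where L: "\<And>n. \<bar>a n + (\<Sum>k<n. d k)\<bar> \<le> L"
    unfolding Bseq_def by auto
  show d_sum: "summable d"
  proof (rule bounded_imp_summable)
    show "(\<Sum>k\<le>n. d k) \<le> L" for n
      using L[of "Suc n"] a[of "Suc n"] by (simp add: lessThan_Suc_atMost)
  qed (rule d)
  then have "convergent (\<lambda>n. \<Sum>k<n. d k)"
    by (simp add: summable_iff_convergent)
  from convergent_diff[OF conv this] show "convergent a" by simp
qed

text \<open>If \<open>r\<close> stayed above \<open>e\<close> from \<open>m\<close> on, then
  \<open>\<alpha> n\<close> would be at most \<open>\<alpha> n * r n / e\<close> there, and the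
  divergent series of \<alpha> would converge.\<close>

lemma frequently_small_of_weighted_summable:
  fixes \<alpha> r :: "nat \<Rightarrow> real"
  assumes \<alpha>: "\<And>k. \<alpha> k > 0" "filterlim (\<lambda>n. \<Sum>k<n. \<alpha> k) at_top sequentially"
    and sum: "summable (\<lambda>k. \<alpha> k * r k)" and "e > 0"
  shows "\<exists>n\<ge>m. r n < e"
proof (rule ccontr)
  assume "\<not> ?thesis"
  then have ge: "r n \<ge> e" if "n \<ge> m" for n using that by force
  have "summable \<alpha>"
  proof (rule summable_comparison_test)
    show "\<exists>N. \<forall>n\<ge>N. norm (\<alpha> n) \<le> (1 / e) * (\<alpha> n * r n)"
    proof (intro exI allI impI)
      fix n assume "n \<ge> m"
      then show "norm (\<alpha> n) \<le> (1 / e) * (\<alpha> n * r n)"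
        using ge[of n] \<alpha>(1)[of n] \<open>e > 0\<close> by (simp add: field_simps)
    qed
    show "summable (\<lambda>n. (1 / e) * (\<alpha> n * r n))"
      using sum by (rule summable_mult)
  qed
  then have "(\<lambda>n. \<Sum>k<n. \<alpha> k) \<longlonglongrightarrow> suminf \<alpha>" by (rule summable_LIMSEQ)
  with \<alpha>(2) show False
    using not_tendsto_and_filterlim_at_infinity filterlim_at_top_imp_at_infinity
    by (metis sequentially_bot)
qed

text \<open>Opial's argument with distances controlled only on a dense subset \<open>T\<close>. A
  subsequence along which the distance to \<open>S\<close> vanishes has a cluster point in
  \<open>S\<close>; convergence of the distances to points of \<open>T\<close> near it then forces
  the whole sequence towards it.\<close>

lemma opial_convergent:
  fixes u :: "nat \<Rightarrow> 'a::euclidean_space"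
  assumes S: "closed S" "S \<noteq> {}" and T: "T \<subseteq> S" "S \<subseteq> closure T"
    and conv: "\<And>y. y \<in> T \<Longrightarrow> convergent (\<lambda>n. (norm (u n - y))\<^sup>2)"
    and freq: "\<And>e m. e > 0 \<Longrightarrow> \<exists>n\<ge>m. infdist (u n) S < e"
  shows "\<exists>l\<in>S. u \<longlonglongrightarrow> l"
proof -
  have dense: "\<exists>y\<in>T. dist y x < e" if "x \<in> S" "e > 0" for x e
    using that T(2) closure_approachable by blast
  from S obtain x0 where "x0 \<in> S" by auto
  with dense[of x0 1] obtain y0 where y0: "y0 \<in> T" by auto
  have "bounded (range u)"
  proof -
    from conv[OF y0] have "Bseq (\<lambda>n. (norm (u n - y0))\<^sup>2)" by (rule convergent_imp_Bseq)
    then obtain K where K: "\<And>n. (norm (u n - y0))\<^sup>2 \<le> K" unfolding Bseq_def by auto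
    have "dist y0 (u n) \<le> sqrt K" for n
      using K[of n] real_le_rsqrt by (simp add: dist_norm norm_minus_commute)
    then show ?thesis unfolding bounded_def by auto
  qed
  have "\<exists>r. strict_mono r \<and> (\<forall>i. infdist (u (r i)) S < 1 / Suc i)"
  proof -
    have "\<exists>n>m. infdist (u n) S < 1 / Suc i" for m i
    proof -
      obtain n where "n \<ge> Suc m" "infdist (u n) S < 1 / Suc i"
        using freq[of "1 / Suc i" "Suc m"] by auto
      then show ?thesis using Suc_le_lessD by blast
    qed
    then obtain f where f: "\<And>m i. f m i > m" "\<And>m i. infdist (u (f m i)) S < 1 / Suc i"
      by metis
    \<comment> \<open>Position \<open>i\<close> is chosen with accuracy \<open>1 / Suc i\<close> and
      beyond position \<open>i - 1\<close>, so one recursion yields both strict monotonicity and the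
      rate.\<close>
    define r where "r = rec_nat (f 0 0) (\<lambda>i m. f m (Suc i))"
    have "r (Suc i) > r i" for i by (simp add: r_def f)
    moreover have "infdist (u (r i)) S < 1 / Suc i" for i
      using f(2) by (cases i) (simp_all only: r_def old.nat.rec)
    ultimately show ?thesis by (auto simp: strict_mono_Suc_iff)
  qed
  then obtain r where r: "strict_mono r" "\<And>i. infdist (u (r i)) S < 1 / Suc i" by auto
  have "bounded (range (u \<circ> r))"
    using \<open>bounded (range u)\<close> by (rule bounded_subset) auto
  then obtain l s where s: "strict_mono s" "(u \<circ> r \<circ> s) \<longlonglongrightarrow> l"
    using bounded_imp_convergent_subsequence[of "u \<circ> r"] by auto
  have "(\<lambda>i. infdist ((u \<circ> r \<circ> s) i) S) \<longlonglongrightarrow> infdist l S"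
    by (intro tendsto_infdist s)
  moreover have "(\<lambda>i. infdist ((u \<circ> r \<circ> s) i) S) \<longlonglongrightarrow> 0"
  proof -
    have "(\<lambda>i. infdist ((u \<circ> r) i) S) \<longlonglongrightarrow> 0"
    proof (rule tendsto_sandwich[OF _ _ tendsto_const])
      show "(\<lambda>i. 1 / real (Suc i)) \<longlonglongrightarrow> 0" by (rule LIMSEQ_Suc[OF lim_1_over_n])
      show "\<forall>\<^sub>F i in sequentially. infdist ((u \<circ> r) i) S \<le> 1 / real (Suc i)"
        by (intro always_eventually allI less_imp_le) (simp only: o_apply r(2))
    qed (simp add: infdist_nonneg)
    from LIMSEQ_subseq_LIMSEQ[OF this s(1)] show ?thesis by (simp add: o_def)
  qed
  ultimately have "infdist l S = 0" by (rule LIMSEQ_unique)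
  then have "l \<in> S" using in_closed_iff_infdist_zero[OF S] by simp
  moreover have "u \<longlonglongrightarrow> l"
  proof (rule metric_LIMSEQ_I)
    fix e :: real assume "e > 0"
    \<comment> \<open>The cluster point \<open>l\<close> may lie outside \<open>T\<close>, so the
      distances to \<open>l\<close> are not known to converge. Those to a nearby \<open>y\<close> in
      \<open>T\<close> do, and their limit is read off along the subsequence; two thirds of
      \<open>e\<close> then cover the distance to \<open>l\<close>.\<close>
    with dense[OF \<open>l \<in> S\<close>, of "e / 3"] obtain y where y: "y \<in> T" "dist y l < e / 3" by auto
    from conv[OF y(1)] obtain c where c: "(\<lambda>n. (norm (u n - y))\<^sup>2) \<longlonglongrightarrow> c"
      by (auto simp: convergent_def)
    have "(\<lambda>n. (norm (u ((r \<circ> s) n) - y))\<^sup>2) \<longlonglongrightarrow> (norm (l - y))\<^sup>2"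
      using s(2) by (intro tendsto_intros) (simp add: o_def)
    moreover have "(\<lambda>n. (norm (u ((r \<circ> s) n) - y))\<^sup>2) \<longlonglongrightarrow> c"
      using LIMSEQ_subseq_LIMSEQ[OF c strict_mono_o[OF r(1) s(1)]] by (simp add: o_def)
    ultimately have "c = (norm (l - y))\<^sup>2" using LIMSEQ_unique by blast
    also have "\<dots> < (e / 3)\<^sup>2"
      using y(2) by (intro power_strict_mono) (auto simp: dist_norm norm_minus_commute)
    finally have "\<forall>\<^sub>F n in sequentially. (norm (u n - y))\<^sup>2 < (e / 3)\<^sup>2"
      by (intro order_tendstoD(2)[OF c])
    then obtain n0 where n0: "\<And>n. n \<ge> n0 \<Longrightarrow> (norm (u n - y))\<^sup>2 < (e / 3)\<^sup>2"
      by (auto simp: eventually_sequentially)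
    have "dist (u n) l < e" if "n \<ge> n0" for n
    proof -
      have "norm (u n - y) < e / 3"
        using power_less_imp_less_base[OF n0[OF that]] \<open>e > 0\<close> by simp
      with y(2) \<open>e > 0\<close> dist_triangle[of "u n" l y] show ?thesis by (simp add: dist_norm)
    qed
    then show "\<exists>n0. \<forall>n\<ge>n0. dist (u n) l < e" by blast
  qed
  ultimately show ?thesis by blast
qed

section \<open>Orthogonal increments\<close>

text \<open>Square-integrable martingale differences, with the vanishing conditional expectation
  expressed by testing against square-integrable variables of the past. In this form the property is
  checked by one integral and passes at once to stopped and to shifted increments.\<close>

locale orthogonal_increments = prob_space M for M :: "'w measure" +
  fixes Fl :: "nat \<Rightarrow> 'w measure" and X :: "nat \<Rightarrow> 'w \<Rightarrow> real"
  assumes subalg: "subalgebra M (Fl k)"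
    and filtration: "subalgebra (Fl (Suc k)) (Fl k)"
    and X_adapted: "X k \<in> borel_measurable (Fl (Suc k))"
    and X_sq: "integrable M (\<lambda>\<omega>. (X k \<omega>)\<^sup>2)"
    and orthogonal: "\<And>k Z. \<lbrakk>Z \<in> borel_measurable (Fl k); integrable M (\<lambda>\<omega>. (Z \<omega>)\<^sup>2)\<rbrakk>
      \<Longrightarrow> integral\<^sup>L M (\<lambda>\<omega>. X k \<omega> * Z \<omega>) = 0"

lemma filtration_mono:
  assumes "\<And>k. subalgebra (Fl (Suc k)) (Fl k)" "k \<le> l"
  shows "subalgebra (Fl l) (Fl k)"
  using assms(2)
proof (induction l rule: dec_induct)
  case (step l)
  then show ?case using assms(1)[of l] by (auto simp: subalgebra_def)
qed (simp add: subalgebra_def)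

lemma integrable_mult_of_squares:
  fixes f g :: "'w \<Rightarrow> real"
  assumes [measurable]: "f \<in> borel_measurable M" "g \<in> borel_measurable M"
    and "integrable M (\<lambda>\<omega>. (f \<omega>)\<^sup>2)" "integrable M (\<lambda>\<omega>. (g \<omega>)\<^sup>2)"
  shows "integrable M (\<lambda>\<omega>. f \<omega> * g \<omega>)"
proof (rule Bochner_Integration.integrable_bound)
  show "integrable M (\<lambda>\<omega>. (f \<omega>)\<^sup>2 + (g \<omega>)\<^sup>2)" using assms by simp
  show "AE \<omega> in M. norm (f \<omega> * g \<omega>) \<le> norm ((f \<omega>)\<^sup>2 + (g \<omega>)\<^sup>2)"
  proof (rule AE_I2)
    fix \<omega>
    have "2 * (\<bar>f \<omega>\<bar> * \<bar>g \<omega>\<bar>) \<le> (f \<omega>)\<^sup>2 + (g \<omega>)\<^sup>2"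
      using sum_squares_bound[of "\<bar>f \<omega>\<bar>" "\<bar>g \<omega>\<bar>"] by simp
    moreover have "0 \<le> \<bar>f \<omega>\<bar> * \<bar>g \<omega>\<bar>" by simp
    ultimately have "\<bar>f \<omega>\<bar> * \<bar>g \<omega>\<bar> \<le> (f \<omega>)\<^sup>2 + (g \<omega>)\<^sup>2" by linarith
    then show "norm (f \<omega> * g \<omega>) \<le> norm ((f \<omega>)\<^sup>2 + (g \<omega>)\<^sup>2)"
      by (simp add: abs_mult)
  qed
qed measurable

context orthogonal_increments
begin

definition S :: "nat \<Rightarrow> 'w \<Rightarrow> real" where
  "S n \<omega> = (\<Sum>k<n. X k \<omega>)"

lemma S_adapted: "S n \<in> borel_measurable (Fl n)"
proof -
  have "X k \<in> borel_measurable (Fl n)" if "k < n" for k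
    using measurable_from_subalg[OF filtration_mono[of Fl "Suc k" n, OF filtration] X_adapted] that
    by simp
  then show ?thesis unfolding S_def by (intro borel_measurable_sum) auto
qed

lemma X_measurable [measurable]: "X k \<in> borel_measurable M"
  by (rule measurable_from_subalg[OF subalg X_adapted])

lemma S_measurable [measurable]: "S n \<in> borel_measurable M"
  by (rule measurable_from_subalg[OF subalg S_adapted])

text \<open>Pythagoras: the past sum \<open>S n\<close> is an admissible test variable for
  \<open>X n\<close>, so the cross term has integral zero. Admissibility requires \<open>S n\<close>
  to be square integrable, hence both claims share one induction.\<close>

lemma S_sq:
  "integrable M (\<lambda>\<omega>. (S n \<omega>)\<^sup>2)"
  "integral\<^sup>L M (\<lambda>\<omega>. (S n \<omega>)\<^sup>2) = (\<Sum>k<n. integral\<^sup>L M (\<lambda>\<omega>. (X k \<omega>)\<^sup>2))"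
proof -
  have "integrable M (\<lambda>\<omega>. (S n \<omega>)\<^sup>2) \<and>
    integral\<^sup>L M (\<lambda>\<omega>. (S n \<omega>)\<^sup>2) = (\<Sum>k<n. integral\<^sup>L M (\<lambda>\<omega>. (X k \<omega>)\<^sup>2))"
  proof (induction n)
    case 0
    then show ?case by (simp add: S_def)
  next
    case (Suc n)
    have eq: "(\<lambda>\<omega>. (S (Suc n) \<omega>)\<^sup>2) = (\<lambda>\<omega>. (S n \<omega>)\<^sup>2 + (X n \<omega>)\<^sup>2 + 2 * (X n \<omega> * S n \<omega>))"
      by (auto simp: S_def power2_eq_square algebra_simps)
    have [simp]: "integrable M (\<lambda>\<omega>. X n \<omega> * S n \<omega>)"
      by (rule integrable_mult_of_squares) (use X_sq Suc in auto)
    show ?case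
      unfolding eq using Suc X_sq orthogonal[OF S_adapted, of n] by simp
  qed
  then show "integrable M (\<lambda>\<omega>. (S n \<omega>)\<^sup>2)"
    "integral\<^sup>L M (\<lambda>\<omega>. (S n \<omega>)\<^sup>2) = (\<Sum>k<n. integral\<^sup>L M (\<lambda>\<omega>. (X k \<omega>)\<^sup>2))" by auto
qed

text \<open>The indicator of an event of the past can be absorbed into the test variable. This makes
  stopped sums an instance of the same locale.\<close>

lemma orthogonal_increments_restrict:
  assumes A: "\<And>k. A k \<in> sets (Fl k)"
  shows "orthogonal_increments M Fl (\<lambda>k \<omega>. X k \<omega> * indicator (A k) \<omega>)"
proof
  have AM [measurable]: "A k \<in> sets M" for k using A subalg[of k] by (auto simp: subalgebra_def)
  have AS: "A k \<in> sets (Fl (Suc k))" for k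
    using A[of k] filtration[of k] by (auto simp: subalgebra_def)
  show "(\<lambda>\<omega>. X k \<omega> * indicator (A k) \<omega>) \<in> borel_measurable (Fl (Suc k))" for k
    by (intro borel_measurable_times X_adapted borel_measurable_indicator AS)
  show "integrable M (\<lambda>\<omega>. (X k \<omega> * indicator (A k) \<omega>)\<^sup>2)" for k
  proof (rule Bochner_Integration.integrable_bound[OF X_sq[of k]])
  qed (auto simp: indicator_def)
  fix k and Z :: "'w \<Rightarrow> real"
  assume Z: "Z \<in> borel_measurable (Fl k)" "integrable M (\<lambda>\<omega>. (Z \<omega>)\<^sup>2)"
  have [measurable]: "Z \<in> borel_measurable M" by (rule measurable_from_subalg[OF subalg Z(1)])
  have "integral\<^sup>L M (\<lambda>\<omega>. X k \<omega> * (indicator (A k) \<omega> * Z \<omega>)) = 0"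
  proof (rule orthogonal)
    show "(\<lambda>\<omega>. indicator (A k) \<omega> * Z \<omega>) \<in> borel_measurable (Fl k)"
      by (intro borel_measurable_times Z borel_measurable_indicator A)
    show "integrable M (\<lambda>\<omega>. (indicator (A k) \<omega> * Z \<omega>)\<^sup>2)"
      by (rule Bochner_Integration.integrable_bound[OF Z(2)]) (auto simp: indicator_def)
  qed
  then show "integral\<^sup>L M (\<lambda>\<omega>. X k \<omega> * indicator (A k) \<omega> * Z \<omega>) = 0"
    by (simp add: mult.assoc)
qed (rule subalg filtration)+

text \<open>This allows the maximal inequality to be applied to the sums that start at an arbitrary
  index \<open>m\<close>.\<close>

lemma orthogonal_increments_shift:
  "orthogonal_increments M (\<lambda>k. Fl (m + k)) (\<lambda>k. X (m + k))"
  by unfold_locales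
    (use subalg filtration X_adapted X_sq orthogonal in auto)

text \<open>The sums are stopped when they first leave the interval. The stopped increments are
  still orthogonal, so Markov's inequality for the stopped square gives the maximal bound.\<close>

lemma Kolmogorov_maximal:
  assumes "\<epsilon> > 0" and bound: "\<And>n. (\<Sum>k<n. integral\<^sup>L M (\<lambda>\<omega>. (X k \<omega>)\<^sup>2)) \<le> c"
  shows "prob {\<omega> \<in> space M. \<exists>n. \<epsilon> \<le> \<bar>S n \<omega>\<bar>} \<le> c / \<epsilon>\<^sup>2"
proof -
  \<comment> \<open>The event involves \<open>S 0\<close> to \<open>S k\<close>, hence only the
    increments before \<open>X k\<close>. It is therefore known in \<open>Fl k\<close>, when the
    decision whether to keep \<open>X k\<close> is made.\<close>
  define A where "A k = {\<omega> \<in> space M. \<forall>i\<le>k. \<bar>S i \<omega>\<bar> < \<epsilon>}" for k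
  have A_sets: "A k \<in> sets (Fl k)" for k
  proof -
    have "{\<omega> \<in> space (Fl k). \<bar>S i \<omega>\<bar> < \<epsilon>} \<in> sets (Fl k)" if "i \<le> k" for i
    proof -
      have [measurable]: "S i \<in> borel_measurable (Fl k)"
        by (rule measurable_from_subalg[OF filtration_mono[of Fl i k, OF filtration that] S_adapted])
      show ?thesis by measurable
    qed
    then have "{\<omega> \<in> space (Fl k). \<forall>i\<in>{..k}. \<bar>S i \<omega>\<bar> < \<epsilon>} \<in> sets (Fl k)"
      by (intro sets.sets_Collect_finite_All) auto
    moreover have "A k = {\<omega> \<in> space (Fl k). \<forall>i\<in>{..k}. \<bar>S i \<omega>\<bar> < \<epsilon>}"
      using subalg[of k] by (auto simp: A_def subalgebra_def)
    ultimately show ?thesis by simp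
  qed
  then have A_M [measurable]: "A k \<in> sets M" for k using subalg[of k] by (auto simp: subalgebra_def)
  interpret T: orthogonal_increments M Fl "\<lambda>k \<omega>. X k \<omega> * indicator (A k) \<omega>"
    by (rule orthogonal_increments_restrict) (rule A_sets)
  have T_sum: "T.S n \<omega> = (\<Sum>k<n. X k \<omega> * indicator (A k) \<omega>)" for n \<omega>
    by (rule T.S_def)
  \<comment> \<open>The increment that leaves the interval is still kept and all later ones are
    dropped, so after an exit the stopped sum stays at its exit value, whose modulus is at least
    \<epsilon>.\<close>
  have T: "(\<omega> \<in> A n \<longrightarrow> T.S n \<omega> = S n \<omega>) \<and> (\<omega> \<notin> A n \<longrightarrow> \<epsilon> \<le> \<bar>T.S n \<omega>\<bar>)"
    if "\<omega> \<in> space M" for n \<omega>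
  proof (induction n)
    case 0
    have "\<omega> \<in> A 0" using that \<open>\<epsilon> > 0\<close> by (simp add: A_def S_def)
    then show ?case by (simp add: T_sum S_def)
  next
    case (Suc n)
    have T_Suc: "T.S (Suc n) \<omega> = T.S n \<omega> + X n \<omega> * indicator (A n) \<omega>"
      and S_Suc: "S (Suc n) \<omega> = S n \<omega> + X n \<omega>" by (simp_all add: T_sum S_def)
    show ?case
    proof (cases "\<omega> \<in> A n")
      case True
      then have "T.S (Suc n) \<omega> = S (Suc n) \<omega>" using Suc T_Suc S_Suc by simp
      moreover have "\<omega> \<in> A (Suc n) \<longleftrightarrow> \<bar>S (Suc n) \<omega>\<bar> < \<epsilon>"
        using True that by (auto simp: A_def le_Suc_eq)
      ultimately show ?thesis by auto
    next
      case False
      moreover have "A (Suc n) \<subseteq> A n" by (auto simp: A_def)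
      ultimately have "\<omega> \<notin> A (Suc n)" by blast
      then show ?thesis using False Suc T_Suc by simp
    qed
  qed
  have bd: "prob (space M - A n) \<le> c / \<epsilon>\<^sup>2" for n
  proof -
    have "prob (space M - A n) \<le> prob {\<omega> \<in> space M. \<epsilon>\<^sup>2 \<le> (T.S n \<omega>)\<^sup>2}"
    proof (rule finite_measure_mono)
      show "space M - A n \<subseteq> {\<omega> \<in> space M. \<epsilon>\<^sup>2 \<le> (T.S n \<omega>)\<^sup>2}"
        using T[of _ n] \<open>\<epsilon> > 0\<close> by (auto simp: abs_le_square_iff[symmetric])
    qed measurable
    also have "\<dots> \<le> integral\<^sup>L M (\<lambda>\<omega>. (T.S n \<omega>)\<^sup>2) / \<epsilon>\<^sup>2"
      by (rule integral_Markov_inequality_measure[where A = "{}"])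
        (use T.S_sq \<open>\<epsilon> > 0\<close> in auto)
    also have "integral\<^sup>L M (\<lambda>\<omega>. (T.S n \<omega>)\<^sup>2) \<le> c"
    proof -
      have "integral\<^sup>L M (\<lambda>\<omega>. (T.S n \<omega>)\<^sup>2) \<le> (\<Sum>k<n. integral\<^sup>L M (\<lambda>\<omega>. (X k \<omega>)\<^sup>2))"
        unfolding T.S_sq
        by (intro sum_mono integral_mono T.X_sq X_sq) (auto simp: indicator_def)
      with bound[of n] show ?thesis by simp
    qed
    finally show ?thesis using \<open>\<epsilon> > 0\<close> by (simp add: divide_right_mono)
  qed
  have "incseq (\<lambda>n. space M - A n)" by (auto simp: incseq_def A_def)
  then have "(\<lambda>n. prob (space M - A n)) \<longlonglongrightarrow> prob (\<Union>n. space M - A n)"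
    by (intro finite_Lim_measure_incseq) auto
  moreover have "(\<Union>n. space M - A n) = {\<omega> \<in> space M. \<exists>n. \<epsilon> \<le> \<bar>S n \<omega>\<bar>}"
    unfolding A_def not_less[symmetric] by blast
  ultimately show ?thesis using bd by (auto intro: LIMSEQ_le_const2)
qed

text \<open>By the maximal inequality, the probability that a sum started at \<open>m\<close> ever
  reaches \<open>e\<close> is at most the variance tail divided by e^2. Letting \<open>m\<close>
  grow makes the event that this happens for every \<open>m\<close> null; running through
  \<open>e = 1 / Suc i\<close> gives the Cauchy property.\<close>

lemma AE_summable:
  assumes sum: "summable (\<lambda>k. integral\<^sup>L M (\<lambda>\<omega>. (X k \<omega>)\<^sup>2))"
  shows "AE \<omega> in M. summable (\<lambda>k. X k \<omega>)"
proof -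
  define tail where "tail m = (\<Sum>k. integral\<^sup>L M (\<lambda>\<omega>. (X (m + k) \<omega>)\<^sup>2))" for m
  have tail: "tail \<longlonglongrightarrow> 0"
    using suminf_exist_split2[OF sum] by (simp add: tail_def[abs_def] add.commute)
  define osc where
    "osc e m = {\<omega> \<in> space M. \<exists>n. e \<le> \<bar>\<Sum>k<n. X (m + k) \<omega>\<bar>}" for e :: real and m
  have osc_M [measurable]: "osc e m \<in> sets M" for e m unfolding osc_def by measurable
  have osc_le: "prob (osc e m) \<le> tail m / e\<^sup>2" if "e > 0" for e m
  proof -
    interpret Y: orthogonal_increments M "\<lambda>k. Fl (m + k)" "\<lambda>k. X (m + k)"
      by (rule orthogonal_increments_shift)
    have "summable (\<lambda>k. integral\<^sup>L M (\<lambda>\<omega>. (X (m + k) \<omega>)\<^sup>2))"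
      using summable_ignore_initial_segment[OF sum, of m] by (simp add: add.commute)
    then have "(\<Sum>k<n. integral\<^sup>L M (\<lambda>\<omega>. (X (m + k) \<omega>)\<^sup>2)) \<le> tail m" for n
      unfolding tail_def by (rule sum_le_suminf) auto
    from Y.Kolmogorov_maximal[OF that this] show ?thesis by (simp add: osc_def Y.S_def)
  qed
  have "AE \<omega> in M. \<exists>m. \<omega> \<notin> osc (1 / Suc i) m" for i
  proof -
    define B where "B = (\<Inter>m. osc (1 / Suc i) m)"
    have [measurable]: "B \<in> sets M" unfolding B_def by measurable
    have "prob B \<le> 0"
    proof (rule LIMSEQ_le_const)
      show "(\<lambda>m. tail m / (1 / Suc i)\<^sup>2) \<longlonglongrightarrow> 0"
        using tendsto_divide[OF tail tendsto_const[of "(1 / real (Suc i))\<^sup>2"]] by simp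
      have "prob B \<le> prob (osc (1 / Suc i) m)" for m
        by (rule finite_measure_mono) (auto simp: B_def)
      then show "\<exists>N. \<forall>m\<ge>N. prob B \<le> tail m / (1 / Suc i)\<^sup>2"
        using order_trans[OF _ osc_le[of "1 / Suc i"]] by simp
    qed
    then have "prob B = 0" by (simp add: measure_le_0_iff)
    then have "AE \<omega> in M. \<omega> \<notin> B"
      using sets.sets_into_space[of B M] by (subst AE_iff_measurable[of B]) (auto simp: emeasure_eq_measure)
    then show ?thesis by (rule AE_mp) (auto simp: B_def)
  qed
  then have "AE \<omega> in M. \<forall>i. \<exists>m. \<omega> \<notin> osc (1 / Suc i) m" by (simp add: AE_all_countable)
  then show ?thesis
  proof (rule AE_mp, intro AE_I2 impI)
    fix \<omega> assume \<omega>: "\<omega> \<in> space M" and small: "\<forall>i. \<exists>m. \<omega> \<notin> osc (1 / Suc i) m"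
    have "Cauchy (\<lambda>n. \<Sum>k<n. X k \<omega>)"
    proof (rule CauchyI')
      fix e :: real assume "e > 0"
      \<comment> \<open>Half of \<open>e\<close> is the budget because two partial sums are compared
        through the one at \<open>m\<close>.\<close>
      then obtain i where i: "1 / real (Suc i) < e / 2"
        using reals_Archimedean[of "e / 2"] by (auto simp: inverse_eq_divide)
      from small obtain m where "\<omega> \<notin> osc (1 / Suc i) m" by blast
      then have m: "\<bar>\<Sum>k<n. X (m + k) \<omega>\<bar> < e / 2" for n
      proof -
        have "\<bar>\<Sum>k<n. X (m + k) \<omega>\<bar> < 1 / real (Suc i)"
          using \<omega> \<open>\<omega> \<notin> osc (1 / Suc i) m\<close> unfolding osc_def by (simp add: not_le)
        with i show ?thesis by linarith
      qed
      have eq: "(\<Sum>k<n. X k \<omega>) = (\<Sum>k<m. X k \<omega>) + (\<Sum>k<n - m. X (m + k) \<omega>)" if "n \<ge> m" for n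
      proof -
        have "(\<Sum>k<m + d. X k \<omega>) = (\<Sum>k<m. X k \<omega>) + (\<Sum>k<d. X (m + k) \<omega>)" for d
          by (induction d) simp_all
        from this[of "n - m"] that show ?thesis by simp
      qed
      show "\<exists>m. \<forall>a\<ge>m. \<forall>b>a. dist (\<Sum>k<a. X k \<omega>) (\<Sum>k<b. X k \<omega>) < e"
      proof (intro exI allI impI)
        fix a b assume "a \<ge> m" "b > a"
        then show "dist (\<Sum>k<a. X k \<omega>) (\<Sum>k<b. X k \<omega>) < e"
          using m[of "a - m"] m[of "b - m"] eq[of a] eq[of b] unfolding dist_real_def by linarith
      qed
    qed
    then show "summable (\<lambda>k. X k \<omega>)"
      by (simp add: summable_iff_convergent Cauchy_convergent_iff)
  qed
qed

end

section \<open>The stochastic Popov process\<close>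

lemma sum_sq_le3: "(a + b + c)\<^sup>2 \<le> 3 * (a\<^sup>2 + b\<^sup>2 + (c::real)\<^sup>2)"
  using sum_squares_bound[of a b] sum_squares_bound[of b c] sum_squares_bound[of a c]
  by (simp add: power2_eq_square algebra_simps)

lemma (in finite_measure) integrable_norm_sq_bound:
  fixes f :: "'a \<Rightarrow> 'b::euclidean_space"
    and g1 :: "'a \<Rightarrow> 'c::euclidean_space" and g2 :: "'a \<Rightarrow> 'd::euclidean_space"
  assumes [measurable]: "f \<in> borel_measurable M"
    and g: "integrable M (\<lambda>x. (norm (g1 x))\<^sup>2)" "integrable M (\<lambda>x. (norm (g2 x))\<^sup>2)"
    and le: "\<And>x. x \<in> space M \<Longrightarrow> norm (f x) \<le> a + b * norm (g1 x) + c * norm (g2 x)"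
  shows "integrable M (\<lambda>x. (norm (f x))\<^sup>2)"
proof (rule Bochner_Integration.integrable_bound)
  show "integrable M (\<lambda>x. 3 * (a\<^sup>2 + b\<^sup>2 * (norm (g1 x))\<^sup>2 + c\<^sup>2 * (norm (g2 x))\<^sup>2))"
    using g by simp
  show "AE x in M. norm ((norm (f x))\<^sup>2)
      \<le> norm (3 * (a\<^sup>2 + b\<^sup>2 * (norm (g1 x))\<^sup>2 + c\<^sup>2 * (norm (g2 x))\<^sup>2))"
  proof (rule AE_I2)
    fix x assume "x \<in> space M"
    then have "(norm (f x))\<^sup>2 \<le> (a + b * norm (g1 x) + c * norm (g2 x))\<^sup>2"
      by (intro power_mono le) auto
    also have "\<dots> \<le> 3 * (a\<^sup>2 + (b * norm (g1 x))\<^sup>2 + (c * norm (g2 x))\<^sup>2)"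
      by (rule sum_sq_le3)
    finally show "norm ((norm (f x))\<^sup>2)
      \<le> norm (3 * (a\<^sup>2 + b\<^sup>2 * (norm (g1 x))\<^sup>2 + c\<^sup>2 * (norm (g2 x))\<^sup>2))"
      by (simp add: power_mult_distrib)
  qed
qed measurable

text \<open>Monotone convergence: the sum has finite integral, so it is finite almost everywhere.
  Its integrability is recorded because the sum later becomes part of a dominating function.\<close>

lemma AE_summable_nonneg:
  fixes r :: "nat \<Rightarrow> 'w \<Rightarrow> real"
  assumes r: "\<And>k. integrable M (r k)" "\<And>k \<omega>. r k \<omega> \<ge> 0"
    and sum: "summable (\<lambda>k. integral\<^sup>L M (r k))"
  shows "AE \<omega> in M. summable (\<lambda>k. r k \<omega>)" "integrable M (\<lambda>\<omega>. \<Sum>k. r k \<omega>)"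
proof -
  have [measurable]: "r k \<in> borel_measurable M" for k using r(1) by auto
  have "(\<integral>\<^sup>+\<omega>. (\<Sum>k. ennreal (r k \<omega>)) \<partial>M) = (\<Sum>k. \<integral>\<^sup>+\<omega>. ennreal (r k \<omega>) \<partial>M)"
    by (rule nn_integral_suminf) measurable
  also have "\<dots> = (\<Sum>k. ennreal (integral\<^sup>L M (r k)))"
    using nn_integral_eq_integral[OF r(1)] r(2) by simp
  also have "\<dots> = ennreal (\<Sum>k. integral\<^sup>L M (r k))"
    by (rule suminf_ennreal2[OF _ sum]) (simp add: r(2))
  finally have fin: "(\<integral>\<^sup>+\<omega>. (\<Sum>k. ennreal (r k \<omega>)) \<partial>M) \<noteq> \<infinity>" by simp
  have "AE \<omega> in M. (\<Sum>k. ennreal (r k \<omega>)) \<noteq> \<infinity>"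
    by (rule nn_integral_PInf_AE[OF _ fin]) measurable
  then show AE: "AE \<omega> in M. summable (\<lambda>k. r k \<omega>)"
  proof eventually_elim
    case (elim \<omega>)
    then show ?case by (intro summable_suminf_not_top r(2)) simp
  qed
  have "AE \<omega> in M. summable (\<lambda>k. norm (r k \<omega>))" using AE r(2) by simp
  moreover have "summable (\<lambda>k. integral\<^sup>L M (\<lambda>\<omega>. norm (r k \<omega>)))" using sum r(2) by simp
  ultimately show "integrable M (\<lambda>\<omega>. \<Sum>k. r k \<omega>)" by (rule integrable_suminf[OF r(1)])
qed

text \<open>Samples are abstracted away: \<open>Q k\<close> is the realised direction, known at time
  \<open>Suc k\<close>. The noise conditions are stated by integrals, \<open>unbiased\<close>
  against every vector determined by the past and \<open>variance\<close> against functions of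
  \<open>h k\<close>. Adaptedness of \<open>F (h k \<omega>)\<close> is a separate assumption
  because \<open>F\<close> is controlled only on \<open>U\<close> and need not be Borel on the whole
  space.\<close>

locale stochastic_popov = prob_space M for M :: "'w measure" +
  fixes Fl :: "nat \<Rightarrow> 'w measure" and U S :: "'a::euclidean_space set" and F :: "'a \<Rightarrow> 'a"
    and Q u h :: "nat \<Rightarrow> 'w \<Rightarrow> 'a" and u0 h0 :: 'a
    and \<alpha> :: "nat \<Rightarrow> real" and \<sigma> C D p \<mu> :: real
  assumes subalg: "subalgebra M (Fl k)"
    and filtration: "subalgebra (Fl (Suc k)) (Fl k)"
    and u_adapted: "u k \<in> borel_measurable (Fl k)"
    and h_adapted: "h k \<in> borel_measurable (Fl k)"
    and Fh_adapted: "(\<lambda>\<omega>. F (h k \<omega>)) \<in> borel_measurable (Fl k)"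
    and Q_adapted: "Q k \<in> borel_measurable (Fl (Suc k))"
    and U: "closed U" "convex U"
    and S: "closed S" "S \<noteq> {}" "S \<subseteq> U"
    and init: "u0 \<in> U" "h0 \<in> U"
      "\<omega> \<in> space M \<Longrightarrow> u 0 \<omega> = u0" "\<omega> \<in> space M \<Longrightarrow> h 0 \<omega> = h0"
    and u_Suc: "\<omega> \<in> space M \<Longrightarrow> u (Suc k) \<omega> = closest_point U (u k \<omega> - \<alpha> k *\<^sub>R Q k \<omega>)"
    and h_Suc: "\<omega> \<in> space M \<Longrightarrow>
      h (Suc k) \<omega> = closest_point U (u (Suc k) \<omega> - \<alpha> (Suc k) *\<^sub>R Q k \<omega>)"
    and unbiased: "\<And>k Z. \<lbrakk>Z \<in> borel_measurable (Fl k);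
        integrable M (\<lambda>\<omega>. (Q k \<omega> - F (h k \<omega>)) \<bullet> Z \<omega>)\<rbrakk>
      \<Longrightarrow> integral\<^sup>L M (\<lambda>\<omega>. (Q k \<omega> - F (h k \<omega>)) \<bullet> Z \<omega>) = 0"
    and variance: "\<And>k f. f \<in> borel_measurable borel \<Longrightarrow>
      (\<integral>\<^sup>+\<omega>. f (h k \<omega>) * ennreal ((norm (Q k \<omega> - F (h k \<omega>)))\<^sup>2) \<partial>M)
        \<le> ennreal (\<sigma>\<^sup>2) * (\<integral>\<^sup>+\<omega>. f (h k \<omega>) \<partial>M)"
    and growth: "C \<ge> 0" "D \<ge> 0" "v \<in> U \<Longrightarrow> norm (F v) \<le> C * norm v + D"
    and sharp: "p > 0" "\<mu> > 0" "\<lbrakk>v \<in> U; y \<in> S\<rbrakk> \<Longrightarrow> \<mu> * infdist v S powr p \<le> F v \<bullet> (v - y)"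
    and \<alpha>: "\<alpha> k > 0" "filterlim (\<lambda>n. \<Sum>k<n. \<alpha> k) at_top sequentially"
      "summable (\<lambda>k. (\<alpha> k)\<^sup>2)"
begin

abbreviation noise :: "nat \<Rightarrow> 'w \<Rightarrow> 'a" where
  "noise k \<omega> \<equiv> Q k \<omega> - F (h k \<omega>)"

text \<open>The initial value is chosen such that \<open>\<alpha> k * B k\<close> bounds the gap between
  \<open>u k\<close> and \<open>h k\<close> also for \<open>k = 0\<close>, where \<open>h k\<close> is arbitrary.\<close>

definition B :: "nat \<Rightarrow> 'w \<Rightarrow> real" where
  "B k \<omega> = (case k of 0 \<Rightarrow> norm (u0 - h0) / \<alpha> 0 | Suc j \<Rightarrow> norm (Q j \<omega>))"

lemma B_simps [simp]: "B 0 \<omega> = norm (u0 - h0) / \<alpha> 0" "B (Suc k) \<omega> = norm (Q k \<omega>)"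
  by (simp_all add: B_def)

lemma measurable_process [measurable]:
  "u k \<in> borel_measurable M" "h k \<in> borel_measurable M"
  "(\<lambda>\<omega>. F (h k \<omega>)) \<in> borel_measurable M" "Q k \<in> borel_measurable M"
  using measurable_from_subalg[OF subalg] u_adapted h_adapted Fh_adapted Q_adapted by blast+

lemma B_measurable [measurable]: "B k \<in> borel_measurable M"
proof (cases k)
  case (Suc j)
  show ?thesis unfolding Suc B_def by simp
qed (simp add: B_def[abs_def])

lemma closest_point_in: "closest_point U v \<in> U"
  using closest_point_in_set[of U] U init by auto

lemma u_in: "\<omega> \<in> space M \<Longrightarrow> u k \<omega> \<in> U"
  by (cases k) (simp_all add: init u_Suc closest_point_in)

lemma h_in: "\<omega> \<in> space M \<Longrightarrow> h k \<omega> \<in> U"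
  by (cases k) (simp_all add: init h_Suc closest_point_in)

text \<open>For positive \<open>k\<close> both points come from the same base: \<open>u k\<close> is
  its own projection and \<open>h k\<close> is the projection of \<open>u k\<close> moved by
  \<open>\<alpha> k\<close> times the previous direction.\<close>

lemma gap:
  assumes "\<omega> \<in> space M"
  shows "norm (u k \<omega> - h k \<omega>) \<le> \<alpha> k * B k \<omega>"
proof (cases k)
  case 0
  then show ?thesis using assms init \<alpha>(1)[of 0] by simp
next
  case (Suc j)
  have "norm (h k \<omega> - u k \<omega>) \<le> norm (u k \<omega> - \<alpha> k *\<^sub>R Q j \<omega> - u k \<omega>)"
    using closest_point_step_le[OF U u_in[OF assms, of k], of "u k \<omega>" "\<alpha> k *\<^sub>R Q j \<omega>"]
      h_Suc[OF assms, of j] Suc by simp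
  then show ?thesis using Suc \<alpha>(1)[of k] by (simp add: norm_minus_commute)
qed

section \<open>Square integrability of noise, directions and iterates\<close>

lemma noise_sq:
  "integrable M (\<lambda>\<omega>. (norm (noise k \<omega>))\<^sup>2)"
  "integral\<^sup>L M (\<lambda>\<omega>. (norm (noise k \<omega>))\<^sup>2) \<le> \<sigma>\<^sup>2"
proof -
  have nn: "(\<integral>\<^sup>+\<omega>. ennreal ((norm (noise k \<omega>))\<^sup>2) \<partial>M) \<le> ennreal (\<sigma>\<^sup>2)"
    using variance[of "\<lambda>_. 1" k] by (simp add: emeasure_space_1)
  show int: "integrable M (\<lambda>\<omega>. (norm (noise k \<omega>))\<^sup>2)"
    by (rule integrableI_bounded) (use nn in \<open>auto intro: le_less_trans\<close>)
  show "integral\<^sup>L M (\<lambda>\<omega>. (norm (noise k \<omega>))\<^sup>2) \<le> \<sigma>\<^sup>2"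
    using nn by (subst (asm) nn_integral_eq_integral[OF int]) auto
qed

lemma Fh_sq_of_h:
  assumes "integrable M (\<lambda>\<omega>. (norm (h k \<omega>))\<^sup>2)"
  shows "integrable M (\<lambda>\<omega>. (norm (F (h k \<omega>)))\<^sup>2)"
  by (rule integrable_norm_sq_bound[OF _ assms assms, of _ D C 0])
    (use growth(3)[OF h_in] in \<open>auto simp: algebra_simps\<close>)

lemma Q_sq_of_h:
  assumes "integrable M (\<lambda>\<omega>. (norm (h k \<omega>))\<^sup>2)"
  shows "integrable M (\<lambda>\<omega>. (norm (Q k \<omega>))\<^sup>2)"
proof (rule integrable_norm_sq_bound[OF _ noise_sq(1)[of k] Fh_sq_of_h[OF assms], of _ 0 1 1])
  show "norm (Q k \<omega>) \<le> 0 + 1 * norm (noise k \<omega>) + 1 * norm (F (h k \<omega>))" for \<omega>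
    using norm_triangle_ineq[of "noise k \<omega>" "F (h k \<omega>)"] by simp
qed measurable

text \<open>The fixed point \<open>u0\<close> of \<open>U\<close> serves as anchor for
  nonexpansiveness. Passing to it and back costs \<open>norm u0\<close> twice, whence the
  constant.\<close>

lemma projected_sq:
  assumes [measurable]: "f \<in> borel_measurable M"
    and v: "integrable M (\<lambda>\<omega>. (norm (v \<omega>))\<^sup>2)" and q: "integrable M (\<lambda>\<omega>. (norm (q \<omega>))\<^sup>2)"
    and f: "\<And>\<omega>. \<omega> \<in> space M \<Longrightarrow> f \<omega> = closest_point U (v \<omega> - c *\<^sub>R q \<omega>)"
  shows "integrable M (\<lambda>\<omega>. (norm (f \<omega> :: 'a))\<^sup>2)"
proof (rule integrable_norm_sq_bound[OF _ v q, of _ "2 * norm u0" 1 "\<bar>c\<bar>"])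
  fix \<omega> assume "\<omega> \<in> space M"
  then have "norm (f \<omega> - u0) \<le> norm (v \<omega> - c *\<^sub>R q \<omega> - u0)"
    using closest_point_step_le[OF U init(1)] f by simp
  also have "\<dots> \<le> norm (v \<omega> - c *\<^sub>R q \<omega>) + norm u0" by (rule norm_triangle_ineq4)
  also have "norm (v \<omega> - c *\<^sub>R q \<omega>) \<le> norm (v \<omega>) + norm (c *\<^sub>R q \<omega>)" by (rule norm_triangle_ineq4)
  finally show "norm (f \<omega>) \<le> 2 * norm u0 + 1 * norm (v \<omega>) + \<bar>c\<bar> * norm (q \<omega>)"
    using norm_triangle_sub[of "f \<omega>" u0] by simp
qed measurable

text \<open>Real-valued integrals of non-integrable functions are zero by convention, so finiteness
  is settled before moments are compared. The induction is joint: \<open>h k\<close> controls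
  \<open>Q k\<close>, which controls \<open>u (Suc k)\<close> and then
  \<open>h (Suc k)\<close>.\<close>

lemma iterates_sq:
  "integrable M (\<lambda>\<omega>. (norm (u k \<omega>))\<^sup>2)" "integrable M (\<lambda>\<omega>. (norm (h k \<omega>))\<^sup>2)"
proof -
  have "integrable M (\<lambda>\<omega>. (norm (u k \<omega>))\<^sup>2) \<and> integrable M (\<lambda>\<omega>. (norm (h k \<omega>))\<^sup>2)"
  proof (induction k)
    case 0
    have "integrable M (\<lambda>\<omega>. (norm (u 0 \<omega>))\<^sup>2) \<longleftrightarrow> integrable M (\<lambda>_::'w. (norm u0)\<^sup>2)"
      by (rule Bochner_Integration.integrable_cong) (simp_all add: init)
    moreover have "integrable M (\<lambda>\<omega>. (norm (h 0 \<omega>))\<^sup>2) \<longleftrightarrow> integrable M (\<lambda>_::'w. (norm h0)\<^sup>2)"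
      by (rule Bochner_Integration.integrable_cong) (simp_all add: init)
    ultimately show ?case by simp
  next
    case (Suc k)
    have Q: "integrable M (\<lambda>\<omega>. (norm (Q k \<omega>))\<^sup>2)" using Suc by (intro Q_sq_of_h) auto
    have u: "integrable M (\<lambda>\<omega>. (norm (u (Suc k) \<omega>))\<^sup>2)"
      by (rule projected_sq[of _ "u k" "Q k" "\<alpha> k"]) (use Suc Q u_Suc in auto)
    have "integrable M (\<lambda>\<omega>. (norm (h (Suc k) \<omega>))\<^sup>2)"
      by (rule projected_sq[of _ "u (Suc k)" "Q k" "\<alpha> (Suc k)"]) (use u Q h_Suc in auto)
    with u show ?case by simp
  qed
  then show "integrable M (\<lambda>\<omega>. (norm (u k \<omega>))\<^sup>2)" "integrable M (\<lambda>\<omega>. (norm (h k \<omega>))\<^sup>2)"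
    by auto
qed

lemma integrable_dist_sq:
  fixes f :: "'w \<Rightarrow> 'a"
  assumes [measurable]: "f \<in> borel_measurable M" and "integrable M (\<lambda>\<omega>. (norm (f \<omega>))\<^sup>2)"
  shows "integrable M (\<lambda>\<omega>. (norm (f \<omega> - y))\<^sup>2)"
  by (rule integrable_norm_sq_bound[OF _ assms(2) assms(2), of _ "norm y" 1 0])
    (use norm_triangle_ineq4[of "f _" y] in \<open>auto simp: algebra_simps\<close>)

lemmas u_dist_sq = integrable_dist_sq[OF measurable_process(1) iterates_sq(1)]
lemmas h_dist_sq = integrable_dist_sq[OF measurable_process(2) iterates_sq(2)]

lemma B_sq: "integrable M (\<lambda>\<omega>. (B k \<omega>)\<^sup>2)"
  by (cases k) (simp_all add: Q_sq_of_h iterates_sq)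

text \<open>The error term of \<open>popov_descent\<close> with \<open>q = Q k\<close> and
  \<open>b = B k\<close>, since \<open>B (Suc k)\<close> is the norm of \<open>Q k\<close>. It is
  the same for all solutions.\<close>

definition r :: "nat \<Rightarrow> 'w \<Rightarrow> real" where
  "r k \<omega> = (\<alpha> k)\<^sup>2 * (2 * (B (Suc k) \<omega>)\<^sup>2 + (B k \<omega>)\<^sup>2)"

lemma r_integrable: "integrable M (r k)"
  unfolding r_def using B_sq[of k] B_sq[of "Suc k"] by simp

lemma r_nonneg: "r k \<omega> \<ge> 0"
  unfolding r_def by simp

text \<open>The triangle inequality through \<open>u k\<close> and the gap bound. The point
  \<open>y\<close> is arbitrary, so the random limit \<open>ubar \<omega>\<close> can later take its
  place.\<close>

lemma h_dist_le:
  assumes "\<omega> \<in> space M"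
  shows "(norm (h k \<omega> - y))\<^sup>2 \<le> 2 * (norm (u k \<omega> - y))\<^sup>2 + 2 * ((\<alpha> k)\<^sup>2 * (B k \<omega>)\<^sup>2)"
proof -
  have "norm (h k \<omega> - y) \<le> norm (u k \<omega> - y) + \<alpha> k * B k \<omega>"
    using gap[OF assms, of k] norm_triangle_ineq[of "h k \<omega> - u k \<omega>" "u k \<omega> - y"]
    by (simp add: norm_minus_commute)
  then have "(norm (h k \<omega> - y))\<^sup>2 \<le> (norm (u k \<omega> - y) + \<alpha> k * B k \<omega>)\<^sup>2"
    by (intro power_mono) auto
  also have "\<dots> \<le> 2 * (norm (u k \<omega> - y))\<^sup>2 + 2 * (\<alpha> k * B k \<omega>)\<^sup>2"
    using sum_squares_bound[of "norm (u k \<omega> - y)" "\<alpha> k * B k \<omega>"]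
    by (simp add: power2_eq_square algebra_simps)
  finally show ?thesis by (simp add: power_mult_distrib)
qed

section \<open>Moment and pathwise estimates relative to one solution\<close>

context
  fixes y
  assumes y: "y \<in> S"
begin

definition X :: "nat \<Rightarrow> 'w \<Rightarrow> real" where
  "X k \<omega> = - 2 * \<alpha> k * (noise k \<omega> \<bullet> (h k \<omega> - y))"

lemma X_measurable [measurable]: "X k \<in> borel_measurable M"
  unfolding X_def by measurable

lemma descent:
  assumes "\<omega> \<in> space M"
  shows "(norm (u (Suc k) \<omega> - y))\<^sup>2 \<le> (norm (u k \<omega> - y))\<^sup>2
    - 2 * \<alpha> k * (\<mu> * infdist (h k \<omega>) S powr p) + (X k \<omega> + r k \<omega>)"
proof -
  have "(norm (u (Suc k) \<omega> - y))\<^sup>2 \<le> (norm (u k \<omega> - y))\<^sup>2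
    - 2 * \<alpha> k * (F (h k \<omega>) \<bullet> (h k \<omega> - y)) - 2 * \<alpha> k * (noise k \<omega> \<bullet> (h k \<omega> - y))
      + (\<alpha> k)\<^sup>2 * (2 * (norm (Q k \<omega>))\<^sup>2 + (B k \<omega>)\<^sup>2)"
    unfolding u_Suc[OF assms]
    by (rule popov_descent) (use U S y gap[OF assms] \<alpha>(1)[of k] in auto)
  moreover have "2 * \<alpha> k * (\<mu> * infdist (h k \<omega>) S powr p) \<le> 2 * \<alpha> k * (F (h k \<omega>) \<bullet> (h k \<omega> - y))"
    by (intro mult_left_mono sharp h_in assms y) (use \<alpha>(1)[of k] in auto)
  ultimately show ?thesis by (simp add: X_def r_def)
qed

lemma noise_inner_integrable:
  assumes [measurable]: "Z \<in> borel_measurable M" and Z: "integrable M (\<lambda>\<omega>. (norm (Z \<omega>))\<^sup>2)"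
  shows "integrable M (\<lambda>\<omega>. noise k \<omega> \<bullet> Z \<omega>)"
proof (rule Bochner_Integration.integrable_bound)
  show "integrable M (\<lambda>\<omega>. norm (noise k \<omega>) * norm (Z \<omega>))"
    by (rule integrable_mult_of_squares) (use noise_sq Z in auto)
qed (auto simp: Cauchy_Schwarz_ineq2)

lemma X_integral: "integrable M (X k)" "integral\<^sup>L M (X k) = 0"
proof -
  have int: "integrable M (\<lambda>\<omega>. noise k \<omega> \<bullet> (h k \<omega> - y))"
    by (rule noise_inner_integrable) (use h_dist_sq in auto)
  then show "integrable M (X k)" unfolding X_def by simp
  have [measurable]: "h k \<in> borel_measurable (Fl k)" by (rule h_adapted)
  have "integral\<^sup>L M (\<lambda>\<omega>. noise k \<omega> \<bullet> (h k \<omega> - y)) = 0"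
    by (rule unbiased[OF _ int]) measurable
  then show "integral\<^sup>L M (X k) = 0" unfolding X_def by simp
qed

text \<open>The estimate (s + t)^2 \<le> 2 s^2 + 2 t^2 is used up to three times: to separate noise
  from \<open>F\<close>, to separate \<open>y\<close> in the growth bound, and, inside
  \<open>h_dist_le\<close>, to replace \<open>h k\<close> by \<open>u k\<close>. This explains the
  factors 2, 4 and 8.\<close>

lemma B_Suc_moment:
  "integral\<^sup>L M (\<lambda>\<omega>. (B (Suc k) \<omega>)\<^sup>2) \<le> 2 * \<sigma>\<^sup>2 + 4 * (C * norm y + D)\<^sup>2
    + 8 * C\<^sup>2 * (integral\<^sup>L M (\<lambda>\<omega>. (norm (u k \<omega> - y))\<^sup>2)
        + (\<alpha> k)\<^sup>2 * integral\<^sup>L M (\<lambda>\<omega>. (B k \<omega>)\<^sup>2))"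
proof -
  have le: "(B (Suc k) \<omega>)\<^sup>2 \<le> 2 * (norm (noise k \<omega>))\<^sup>2 + (4 * (C * norm y + D)\<^sup>2
    + 8 * C\<^sup>2 * ((norm (u k \<omega> - y))\<^sup>2 + (\<alpha> k)\<^sup>2 * (B k \<omega>)\<^sup>2))" if "\<omega> \<in> space M" for \<omega>
  proof -
    have sq: "(s + t)\<^sup>2 \<le> 2 * s\<^sup>2 + 2 * t\<^sup>2" for s t :: real
      using sum_squares_bound[of s t] by (simp add: power2_eq_square algebra_simps)
    have "norm (Q k \<omega>) \<le> norm (noise k \<omega>) + norm (F (h k \<omega>))"
      using norm_triangle_ineq[of "noise k \<omega>" "F (h k \<omega>)"] by simp
    then have "(norm (Q k \<omega>))\<^sup>2 \<le> (norm (noise k \<omega>) + norm (F (h k \<omega>)))\<^sup>2"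
      by (intro power_mono) auto
    also have "\<dots> \<le> 2 * (norm (noise k \<omega>))\<^sup>2 + 2 * (norm (F (h k \<omega>)))\<^sup>2" by (rule sq)
    finally have 1: "(norm (Q k \<omega>))\<^sup>2 \<le> 2 * (norm (noise k \<omega>))\<^sup>2 + 2 * (norm (F (h k \<omega>)))\<^sup>2" .
    have "norm (F (h k \<omega>)) \<le> C * norm (h k \<omega>) + D" by (rule growth(3)[OF h_in[OF that]])
    also have "\<dots> \<le> C * (norm (h k \<omega> - y) + norm y) + D"
      using norm_triangle_sub[of "h k \<omega>" y] growth(1) by (intro add_right_mono mult_left_mono) auto
    finally have "(norm (F (h k \<omega>)))\<^sup>2 \<le> (C * norm (h k \<omega> - y) + (C * norm y + D))\<^sup>2"
      by (intro power_mono) (auto simp: algebra_simps)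
    also have "\<dots> \<le> 2 * (C * norm (h k \<omega> - y))\<^sup>2 + 2 * (C * norm y + D)\<^sup>2" by (rule sq)
    also have "(C * norm (h k \<omega> - y))\<^sup>2 \<le> C\<^sup>2 * (2 * (norm (u k \<omega> - y))\<^sup>2 + 2 * ((\<alpha> k)\<^sup>2 * (B k \<omega>)\<^sup>2))"
      unfolding power_mult_distrib by (intro mult_left_mono h_dist_le that) auto
    finally show ?thesis using 1 by (simp add: algebra_simps)
  qed
  have "integral\<^sup>L M (\<lambda>\<omega>. (B (Suc k) \<omega>)\<^sup>2) \<le> integral\<^sup>L M (\<lambda>\<omega>. 2 * (norm (noise k \<omega>))\<^sup>2
    + (4 * (C * norm y + D)\<^sup>2 + 8 * C\<^sup>2 * ((norm (u k \<omega> - y))\<^sup>2 + (\<alpha> k)\<^sup>2 * (B k \<omega>)\<^sup>2)))"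
    by (rule integral_mono[OF B_sq _ le]) (use noise_sq(1)[of k] u_dist_sq B_sq[of k] in auto)
  also have "\<dots> = 2 * integral\<^sup>L M (\<lambda>\<omega>. (norm (noise k \<omega>))\<^sup>2) + (4 * (C * norm y + D)\<^sup>2
    + 8 * C\<^sup>2 * (integral\<^sup>L M (\<lambda>\<omega>. (norm (u k \<omega> - y))\<^sup>2)
        + (\<alpha> k)\<^sup>2 * integral\<^sup>L M (\<lambda>\<omega>. (B k \<omega>)\<^sup>2)))"
    using noise_sq(1)[of k] u_dist_sq[of k] B_sq[of k] by (simp add: prob_space)
  finally show ?thesis using noise_sq(2)[of k] by simp
qed

lemma moments_bounded:
  "\<exists>c. \<forall>k. integral\<^sup>L M (\<lambda>\<omega>. (norm (u k \<omega> - y))\<^sup>2) \<le> c \<and>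
    integral\<^sup>L M (\<lambda>\<omega>. (norm (h k \<omega> - y))\<^sup>2) \<le> c \<and> integral\<^sup>L M (\<lambda>\<omega>. (B k \<omega>)\<^sup>2) \<le> c"
proof -
  define a where "a k = integral\<^sup>L M (\<lambda>\<omega>. (norm (u k \<omega> - y))\<^sup>2)" for k
  define b where "b k = integral\<^sup>L M (\<lambda>\<omega>. (B k \<omega>)\<^sup>2)" for k
  \<comment> \<open>The potential: \<open>a\<close> and \<open>b\<close> each feed on the other, and
    the weight \<open>(\<alpha> k)\<^sup>2\<close> is exactly that of the old direction in the error
    term \<open>r k\<close>.\<close>
  define v where "v k = a k + (\<alpha> k)\<^sup>2 * b k" for k
  define K where "K = 2 * \<sigma>\<^sup>2 + 4 * (C * norm y + D)\<^sup>2 + 8 * C\<^sup>2"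
  define \<delta> where "\<delta> k = K * (2 * (\<alpha> k)\<^sup>2 + (\<alpha> (Suc k))\<^sup>2)" for k
  have a0: "a k \<ge> 0" and b0: "b k \<ge> 0" for k by (simp_all add: a_def b_def)
  have v0: "v k \<ge> 0" for k by (simp add: v_def a0 b0)
  have K0: "K \<ge> 0" by (simp add: K_def)
  have b_Suc: "b (Suc k) \<le> K * (1 + v k)" for k
  proof -
    have "b (Suc k) \<le> (2 * \<sigma>\<^sup>2 + 4 * (C * norm y + D)\<^sup>2) + 8 * C\<^sup>2 * v k"
      using B_Suc_moment[of k] by (simp add: a_def b_def v_def)
    also have "\<dots> \<le> K + K * v k"
      by (intro add_mono mult_right_mono v0) (auto simp: K_def)
    finally show ?thesis by (simp add: algebra_simps)
  qed
  have a_Suc: "a (Suc k) \<le> a k + (\<alpha> k)\<^sup>2 * (2 * b (Suc k) + b k)" for k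
  proof -
    have "a (Suc k) \<le> integral\<^sup>L M (\<lambda>\<omega>. (norm (u k \<omega> - y))\<^sup>2 + (X k \<omega> + r k \<omega>))"
      unfolding a_def
    proof (rule integral_mono[OF u_dist_sq])
      show "(norm (u (Suc k) \<omega> - y))\<^sup>2 \<le> (norm (u k \<omega> - y))\<^sup>2 + (X k \<omega> + r k \<omega>)"
        if "\<omega> \<in> space M" for \<omega>
      proof -
        have "0 \<le> 2 * \<alpha> k * (\<mu> * infdist (h k \<omega>) S powr p)"
          using \<alpha>(1)[of k] sharp(2) by simp
        with descent[OF that, of k] show ?thesis by linarith
      qed
    qed (use u_dist_sq X_integral r_integrable in auto)
    also have "\<dots> = a k + integral\<^sup>L M (r k)"
      using u_dist_sq X_integral r_integrable by (simp add: a_def)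
    also have "integral\<^sup>L M (r k) = (\<alpha> k)\<^sup>2 * (2 * b (Suc k) + b k)"
      using B_sq[of k] B_sq[of "Suc k"] by (simp add: r_def[abs_def] b_def)
    finally show ?thesis .
  qed
  have "v (Suc k) \<le> v k + \<delta> k * (1 + v k)" for k
  proof -
    \<comment> \<open>The term with \<open>b k\<close> from \<open>a_Suc\<close> is already
      contained in \<open>v k\<close>. Only \<open>b (Suc k)\<close> remains, twice from the error
      and once from the new potential, and \<open>b_Suc\<close> bounds it by
      \<open>v k\<close>.\<close>
    have "v (Suc k) \<le> v k + (2 * (\<alpha> k)\<^sup>2 + (\<alpha> (Suc k))\<^sup>2) * b (Suc k)"
      using a_Suc[of k] by (simp add: v_def algebra_simps)
    also have "\<dots> \<le> v k + (2 * (\<alpha> k)\<^sup>2 + (\<alpha> (Suc k))\<^sup>2) * (K * (1 + v k))"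
      by (intro add_left_mono mult_left_mono b_Suc) auto
    finally show ?thesis by (simp add: \<delta>_def algebra_simps)
  qed
  moreover have "\<delta> k \<ge> 0" for k by (simp add: \<delta>_def K0)
  moreover have "summable \<delta>"
  proof -
    have "summable (\<lambda>k. (\<alpha> (Suc k))\<^sup>2)" using \<alpha>(3) by (subst summable_Suc_iff)
    with \<alpha>(3) show ?thesis unfolding \<delta>_def by (intro summable_mult summable_add)
  qed
  ultimately have vb: "1 + v n \<le> (1 + v 0) * exp (suminf \<delta>)" for n
    using v0 by (intro bounded_of_summable_growth) auto
  define c1 where "c1 = (1 + v 0) * exp (suminf \<delta>)"
  have c10: "c1 \<ge> 0" using vb[of 0] v0[of 0] by (simp add: c1_def)
  \<comment> \<open>The recursion bounds \<open>b\<close> from index 1 on; \<open>b 0\<close> stems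
    from the arbitrary initial points and is added by hand.\<close>
  have b_le: "b k \<le> K * c1 + b 0" for k
  proof (cases k)
    case (Suc j)
    have "b k \<le> K * c1"
      using b_Suc[of j] mult_left_mono[OF vb[of j] K0] by (simp add: Suc c1_def)
    with b0[of 0] show ?thesis by linarith
  qed (simp add: K0 c10)
  have v_le: "v k \<le> c1" for k using vb[of k] by (simp add: c1_def)
  have h_le: "integral\<^sup>L M (\<lambda>\<omega>. (norm (h k \<omega> - y))\<^sup>2) \<le> 2 * c1" for k
  proof -
    have "integral\<^sup>L M (\<lambda>\<omega>. (norm (h k \<omega> - y))\<^sup>2)
      \<le> integral\<^sup>L M (\<lambda>\<omega>. 2 * (norm (u k \<omega> - y))\<^sup>2 + 2 * ((\<alpha> k)\<^sup>2 * (B k \<omega>)\<^sup>2))"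
      by (rule integral_mono[OF h_dist_sq _ h_dist_le]) (use u_dist_sq B_sq[of k] in auto)
    also have "\<dots> = 2 * v k"
      using u_dist_sq[of k] B_sq[of k] by (simp add: v_def a_def b_def)
    finally show ?thesis using v_le[of k] by simp
  qed
  have "a k \<le> c1" for k
    using v_le[of k] mult_nonneg_nonneg[OF zero_le_power2[of "\<alpha> k"] b0[of k]]
    unfolding v_def by linarith
  then have "a k \<le> 2 * c1 + (K * c1 + b 0) \<and>
    integral\<^sup>L M (\<lambda>\<omega>. (norm (h k \<omega> - y))\<^sup>2) \<le> 2 * c1 + (K * c1 + b 0) \<and>
    b k \<le> 2 * c1 + (K * c1 + b 0)" for k
    using h_le[of k] b_le[of k] c10 b0[of 0] mult_nonneg_nonneg[OF K0 c10]
    by (smt (verit))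
  then show ?thesis unfolding a_def b_def by blast
qed

lemma r_summable: "summable (\<lambda>k. integral\<^sup>L M (r k))"
proof -
  obtain c where c: "\<And>k. integral\<^sup>L M (\<lambda>\<omega>. (B k \<omega>)\<^sup>2) \<le> c" using moments_bounded by blast
  show ?thesis
  proof (rule summable_comparison_test)
    show "\<exists>N. \<forall>n\<ge>N. norm (integral\<^sup>L M (r n)) \<le> (\<alpha> n)\<^sup>2 * (3 * c)"
    proof (intro exI allI impI)
      fix n
      have "integral\<^sup>L M (r n) = (\<alpha> n)\<^sup>2 *
          (2 * integral\<^sup>L M (\<lambda>\<omega>. (B (Suc n) \<omega>)\<^sup>2) + integral\<^sup>L M (\<lambda>\<omega>. (B n \<omega>)\<^sup>2))"
        using B_sq[of n] B_sq[of "Suc n"] by (simp add: r_def[abs_def])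
      also have "\<dots> \<le> (\<alpha> n)\<^sup>2 * (3 * c)"
        using c[of n] c[of "Suc n"] by (intro mult_left_mono) auto
      finally show "norm (integral\<^sup>L M (r n)) \<le> (\<alpha> n)\<^sup>2 * (3 * c)"
        by (simp add: integral_nonneg r_nonneg)
    qed
    show "summable (\<lambda>n. (\<alpha> n)\<^sup>2 * (3 * c))" using \<alpha>(3) by (rule summable_mult2)
  qed
qed

text \<open>The noise depends on \<open>h k\<close>, so the expectation of the product does not
  simply factor. The variance condition with weight |v - y|^2 supplies the product bound, and no
  fourth moments enter.\<close>

lemma X_sq:
  "integrable M (\<lambda>\<omega>. (X k \<omega>)\<^sup>2)"
  "integral\<^sup>L M (\<lambda>\<omega>. (X k \<omega>)\<^sup>2)
    \<le> 4 * (\<alpha> k)\<^sup>2 * (\<sigma>\<^sup>2 * integral\<^sup>L M (\<lambda>\<omega>. (norm (h k \<omega> - y))\<^sup>2))"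
proof -
  define c where "c = \<sigma>\<^sup>2 * integral\<^sup>L M (\<lambda>\<omega>. (norm (h k \<omega> - y))\<^sup>2)"
  have "(\<integral>\<^sup>+\<omega>. ennreal ((norm (h k \<omega> - y))\<^sup>2) * ennreal ((norm (noise k \<omega>))\<^sup>2) \<partial>M)
    \<le> ennreal (\<sigma>\<^sup>2) * (\<integral>\<^sup>+\<omega>. ennreal ((norm (h k \<omega> - y))\<^sup>2) \<partial>M)"
    by (rule variance[of "\<lambda>v. ennreal ((norm (v - y))\<^sup>2)"]) measurable
  also have "\<dots> = ennreal c"
    by (subst nn_integral_eq_integral[OF h_dist_sq]) (auto simp: c_def ennreal_mult)
  finally have nn: "(\<integral>\<^sup>+\<omega>. ennreal ((norm (h k \<omega> - y))\<^sup>2 * (norm (noise k \<omega>))\<^sup>2) \<partial>M) \<le> ennreal c"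
    by (simp add: ennreal_mult)
  have int: "integrable M (\<lambda>\<omega>. (norm (h k \<omega> - y))\<^sup>2 * (norm (noise k \<omega>))\<^sup>2)"
    by (rule integrableI_bounded) (use nn in \<open>auto intro: le_less_trans\<close>)
  have c: "integral\<^sup>L M (\<lambda>\<omega>. (norm (h k \<omega> - y))\<^sup>2 * (norm (noise k \<omega>))\<^sup>2) \<le> c"
    using nn by (subst (asm) nn_integral_eq_integral[OF int]) (auto simp: c_def)
  have le: "(X k \<omega>)\<^sup>2 \<le> 4 * (\<alpha> k)\<^sup>2 * ((norm (h k \<omega> - y))\<^sup>2 * (norm (noise k \<omega>))\<^sup>2)" for \<omega>
  proof -
    have "(noise k \<omega> \<bullet> (h k \<omega> - y))\<^sup>2 \<le> (norm (h k \<omega> - y))\<^sup>2 * (norm (noise k \<omega>))\<^sup>2"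
      using Cauchy_Schwarz_ineq[of "noise k \<omega>" "h k \<omega> - y"]
      by (simp add: power2_norm_eq_inner mult.commute)
    then show ?thesis by (simp add: X_def power_mult_distrib mult_left_mono)
  qed
  show int': "integrable M (\<lambda>\<omega>. (X k \<omega>)\<^sup>2)"
    by (rule Bochner_Integration.integrable_bound[OF integrable_mult_right[OF int, of "4 * (\<alpha> k)\<^sup>2"]])
      (use le in auto)
  have "integral\<^sup>L M (\<lambda>\<omega>. (X k \<omega>)\<^sup>2)
    \<le> integral\<^sup>L M (\<lambda>\<omega>. 4 * (\<alpha> k)\<^sup>2 * ((norm (h k \<omega> - y))\<^sup>2 * (norm (noise k \<omega>))\<^sup>2))"
    by (rule integral_mono[OF int' _ le]) (use int in auto)
  also have "\<dots> \<le> 4 * (\<alpha> k)\<^sup>2 * c"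
    using c by (simp add: mult_left_mono)
  finally show "integral\<^sup>L M (\<lambda>\<omega>. (X k \<omega>)\<^sup>2)
    \<le> 4 * (\<alpha> k)\<^sup>2 * (\<sigma>\<^sup>2 * integral\<^sup>L M (\<lambda>\<omega>. (norm (h k \<omega> - y))\<^sup>2))"
    by (simp add: c_def)
qed

lemma X_sq_summable: "summable (\<lambda>k. integral\<^sup>L M (\<lambda>\<omega>. (X k \<omega>)\<^sup>2))"
proof -
  obtain c where c: "\<And>k. integral\<^sup>L M (\<lambda>\<omega>. (norm (h k \<omega> - y))\<^sup>2) \<le> c"
    using moments_bounded by blast
  show ?thesis
  proof (rule summable_comparison_test)
    show "\<exists>N. \<forall>n\<ge>N. norm (integral\<^sup>L M (\<lambda>\<omega>. (X n \<omega>)\<^sup>2)) \<le> (\<alpha> n)\<^sup>2 * (4 * (\<sigma>\<^sup>2 * c))"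
    proof (intro exI allI impI)
      fix n
      have "integral\<^sup>L M (\<lambda>\<omega>. (X n \<omega>)\<^sup>2) \<le> 4 * (\<alpha> n)\<^sup>2 * (\<sigma>\<^sup>2 * c)"
        by (rule order_trans[OF X_sq(2)]) (use c[of n] in \<open>intro mult_left_mono; simp\<close>)
      then show "norm (integral\<^sup>L M (\<lambda>\<omega>. (X n \<omega>)\<^sup>2)) \<le> (\<alpha> n)\<^sup>2 * (4 * (\<sigma>\<^sup>2 * c))"
        by (simp add: mult_ac)
    qed
    show "summable (\<lambda>n. (\<alpha> n)\<^sup>2 * (4 * (\<sigma>\<^sup>2 * c)))" using \<alpha>(3) by (rule summable_mult2)
  qed
qed

text \<open>A scalar test variable \<open>Z\<close> is turned into the vector test variable
  \<open>(- 2 * \<alpha> k * Z \<omega>) *\<^sub>R (h k \<omega> - y)\<close>, which is again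
  determined by the past.\<close>

lemma X_orthogonal: "orthogonal_increments M Fl X"
proof
  show "X k \<in> borel_measurable (Fl (Suc k))" for k
  proof -
    have [measurable]: "h k \<in> borel_measurable (Fl (Suc k))" "Q k \<in> borel_measurable (Fl (Suc k))"
      "(\<lambda>\<omega>. F (h k \<omega>)) \<in> borel_measurable (Fl (Suc k))"
      using measurable_from_subalg[OF filtration] h_adapted Fh_adapted Q_adapted by blast+
    show ?thesis unfolding X_def by measurable
  qed
  fix k and Z :: "'w \<Rightarrow> real"
  assume Z [measurable]: "Z \<in> borel_measurable (Fl k)" and "integrable M (\<lambda>\<omega>. (Z \<omega>)\<^sup>2)"
  have [measurable]: "h k \<in> borel_measurable (Fl k)" by (rule h_adapted)
  have ZM [measurable]: "Z \<in> borel_measurable M" by (rule measurable_from_subalg[OF subalg Z])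
  have eq: "(\<lambda>\<omega>. X k \<omega> * Z \<omega>) = (\<lambda>\<omega>. noise k \<omega> \<bullet> ((- 2 * \<alpha> k * Z \<omega>) *\<^sub>R (h k \<omega> - y)))"
    by (auto simp: X_def)
  have "integrable M (\<lambda>\<omega>. X k \<omega> * Z \<omega>)"
    by (rule integrable_mult_of_squares) (use X_sq \<open>integrable M (\<lambda>\<omega>. (Z \<omega>)\<^sup>2)\<close> in auto)
  then show "integral\<^sup>L M (\<lambda>\<omega>. X k \<omega> * Z \<omega>) = 0"
    unfolding eq by (intro unbiased) measurable
qed (rule subalg filtration X_sq)+

lemma AE_convergent_dist:
  "AE \<omega> in M. convergent (\<lambda>k. (norm (u k \<omega> - y))\<^sup>2) \<and>
    summable (\<lambda>k. \<alpha> k * infdist (h k \<omega>) S powr p) \<and> (\<lambda>k. u k \<omega> - h k \<omega>) \<longlonglongrightarrow> 0"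
proof -
  have "AE \<omega> in M. summable (\<lambda>k. X k \<omega>)"
    using orthogonal_increments.AE_summable[OF X_orthogonal X_sq_summable] .
  moreover have "AE \<omega> in M. summable (\<lambda>k. r k \<omega>)"
    by (rule AE_summable_nonneg[OF r_integrable r_nonneg r_summable])
  ultimately show ?thesis
    using AE_space
  proof eventually_elim
    case (elim \<omega>)
    have "0 \<le> 2 * \<alpha> k * (\<mu> * infdist (h k \<omega>) S powr p)" for k
      using \<alpha>(1)[of k] sharp(2) by simp
    note limits = descent_convergent[of "\<lambda>k. (norm (u k \<omega> - y))\<^sup>2",
        OF _ this summable_add[OF elim(1,2)] descent[OF elim(3)]]
    have conv: "convergent (\<lambda>k. (norm (u k \<omega> - y))\<^sup>2)" by (rule limits(1)) simp
    have drift: "summable (\<lambda>k. 2 * \<alpha> k * (\<mu> * infdist (h k \<omega>) S powr p))"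
      by (rule limits(2)) simp
    have "summable (\<lambda>k. \<alpha> k * infdist (h k \<omega>) S powr p)"
      using summable_mult[OF drift, of "1 / (2 * \<mu>)"] sharp(2) by simp
    moreover have "(\<lambda>k. u k \<omega> - h k \<omega>) \<longlonglongrightarrow> 0"
    proof (rule Lim_null_comparison)
      show "\<forall>\<^sub>F k in sequentially. norm (u k \<omega> - h k \<omega>) \<le> \<alpha> k * B k \<omega>"
        by (intro always_eventually allI gap elim)
      \<comment> \<open>Each \<open>(\<alpha> k * B k \<omega>)\<^sup>2\<close> is one of the
        summands of \<open>r k \<omega>\<close>, so summability of the errors also closes the gap
        along the path.\<close>
      have "summable (\<lambda>k. (\<alpha> k * B k \<omega>)\<^sup>2)"
        by (rule summable_comparison_test[OF _ elim(2)])
          (auto simp: r_def power_mult_distrib intro!: mult_left_mono)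
      from summable_LIMSEQ_zero[OF this] show "(\<lambda>k. \<alpha> k * B k \<omega>) \<longlonglongrightarrow> 0"
        by (simp add: power_tendsto_0_iff)
    qed
    ultimately show ?case using conv by simp
  qed
qed

end

section \<open>The almost sure limit\<close>

lemma AE_convergent: "AE \<omega> in M. \<exists>l\<in>S. (\<lambda>k. u k \<omega>) \<longlonglongrightarrow> l \<and> (\<lambda>k. h k \<omega>) \<longlonglongrightarrow> l"
proof -
  obtain T where T: "countable T" "T \<subseteq> S" "S \<subseteq> closure T"
    using separable[of S] by blast
  \<comment> \<open>The two conclusions that do not mention \<open>y\<close> are stated under the
    quantifier over \<open>T\<close>, so a point of \<open>T\<close> is required to extract
    them.\<close>
  then have "T \<noteq> {}" using S by auto
  \<comment> \<open>The exceptional null set depends on \<open>y\<close>; countability of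
    \<open>T\<close> allows one null set for all of \<open>T\<close>.\<close>
  have "AE \<omega> in M. \<forall>y\<in>T. convergent (\<lambda>k. (norm (u k \<omega> - y))\<^sup>2) \<and>
    summable (\<lambda>k. \<alpha> k * infdist (h k \<omega>) S powr p) \<and> (\<lambda>k. u k \<omega> - h k \<omega>) \<longlonglongrightarrow> 0"
    using AE_convergent_dist T by (subst AE_ball_countable) auto
  then show ?thesis
  proof eventually_elim
    case (elim \<omega>)
    with \<open>T \<noteq> {}\<close> have sum: "summable (\<lambda>k. \<alpha> k * infdist (h k \<omega>) S powr p)"
      and diff: "(\<lambda>k. u k \<omega> - h k \<omega>) \<longlonglongrightarrow> 0" by auto
    have "\<exists>l\<in>S. (\<lambda>k. u k \<omega>) \<longlonglongrightarrow> l"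
    proof (rule opial_convergent[OF S(1,2) T(2,3)])
      show "convergent (\<lambda>n. (norm (u n \<omega> - y))\<^sup>2)" if "y \<in> T" for y using elim that by blast
      fix e :: real and m :: nat
      assume "e > 0"
      then obtain n0 where n0: "\<And>n. n \<ge> n0 \<Longrightarrow> norm (u n \<omega> - h n \<omega>) < e / 2"
        using LIMSEQ_D[OF diff, of "e / 2"] by auto
      obtain n where n: "n \<ge> max m n0" "infdist (h n \<omega>) S powr p < (e / 2) powr p"
        using frequently_small_of_weighted_summable[OF \<alpha>(1,2) sum, of "(e / 2) powr p" "max m n0"]
          \<open>e > 0\<close> by auto
      \<comment> \<open>Sharpness controls the distance of \<open>h n\<close>, not of
        \<open>u n\<close>. Half of \<open>e\<close> goes to this distance, recovered from its power
        by monotonicity for positive \<open>p\<close>, and half to the gap.\<close>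
      have "infdist (h n \<omega>) S < e / 2"
      proof (rule ccontr)
        assume "\<not> ?thesis"
        then have "(e / 2) powr p \<le> infdist (h n \<omega>) S powr p"
          using \<open>e > 0\<close> sharp(1) by (intro powr_mono2) auto
        with n(2) show False by simp
      qed
      moreover have "infdist (u n \<omega>) S \<le> infdist (h n \<omega>) S + norm (u n \<omega> - h n \<omega>)"
        using infdist_triangle[of "u n \<omega>" S "h n \<omega>"] by (simp add: dist_norm)
      ultimately have "infdist (u n \<omega>) S < e" using n0[of n] n(1) by simp
      then show "\<exists>n\<ge>m. infdist (u n \<omega>) S < e" using n(1) by auto
    qed
    then obtain l where l: "l \<in> S" "(\<lambda>k. u k \<omega>) \<longlonglongrightarrow> l" by auto
    moreover have "(\<lambda>k. h k \<omega>) \<longlonglongrightarrow> l" using tendsto_diff[OF l(2) diff] by simp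
    ultimately show ?case by blast
  qed
qed

text \<open>The Cauchy condition describes a measurable event, and the default \<open>u0\<close>
  keeps the value in \<open>U\<close> at every sample point, also where the iterates
  diverge.\<close>

definition ubar :: "'w \<Rightarrow> 'a" where
  "ubar \<omega> = (if Cauchy (\<lambda>k. u k \<omega>) then lim (\<lambda>k. u k \<omega>) else u0)"

lemma ubar_measurable [measurable]: "ubar \<in> borel_measurable M"
proof -
  have [measurable]: "{\<omega> \<in> space M. Cauchy (\<lambda>k. u k \<omega>)} \<in> sets M"
    by (rule sets_Collect_Cauchy) measurable
  show ?thesis unfolding ubar_def[abs_def]
    by (rule measurable_If) (auto intro!: borel_measurable_lim_metric)
qed

lemma ubar_in: "\<omega> \<in> space M \<Longrightarrow> ubar \<omega> \<in> U"
proof (cases "Cauchy (\<lambda>k. u k \<omega>)")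
  case True
  assume "\<omega> \<in> space M"
  moreover from True have "(\<lambda>k. u k \<omega>) \<longlonglongrightarrow> ubar \<omega>"
    by (simp add: ubar_def Cauchy_convergent_iff convergent_LIMSEQ_iff)
  ultimately show ?thesis
    using closed_sequentially[OF U(1), of "\<lambda>k. u k \<omega>"] u_in by blast
qed (simp add: ubar_def init)

lemma AE_tendsto_ubar:
  "AE \<omega> in M. ubar \<omega> \<in> S \<and> (\<lambda>k. u k \<omega>) \<longlonglongrightarrow> ubar \<omega> \<and> (\<lambda>k. h k \<omega>) \<longlonglongrightarrow> ubar \<omega>"
  using AE_convergent
proof eventually_elim
  case (elim \<omega>)
  then obtain l where l: "l \<in> S" "(\<lambda>k. u k \<omega>) \<longlonglongrightarrow> l" "(\<lambda>k. h k \<omega>) \<longlonglongrightarrow> l" by auto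
  then have "ubar \<omega> = l" by (auto simp: ubar_def limI LIMSEQ_imp_Cauchy)
  with l show ?case by simp
qed

section \<open>Mean-square convergence and second moments\<close>

lemma ubar_sq: "integrable M (\<lambda>\<omega>. (norm (ubar \<omega> - y))\<^sup>2)" if y: "y \<in> S"
proof -
  obtain c where c: "\<And>k. integral\<^sup>L M (\<lambda>\<omega>. (norm (u k \<omega> - y))\<^sup>2) \<le> c"
    using moments_bounded[OF y] by blast
  have "(\<integral>\<^sup>+\<omega>. ennreal ((norm (ubar \<omega> - y))\<^sup>2) \<partial>M)
    = (\<integral>\<^sup>+\<omega>. liminf (\<lambda>k. ennreal ((norm (u k \<omega> - y))\<^sup>2)) \<partial>M)"
  proof (rule nn_integral_cong_AE)
    show "AE \<omega> in M. ennreal ((norm (ubar \<omega> - y))\<^sup>2) = liminf (\<lambda>k. ennreal ((norm (u k \<omega> - y))\<^sup>2))"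
      using AE_tendsto_ubar
    proof eventually_elim
      case (elim \<omega>)
      then have "(\<lambda>k. ennreal ((norm (u k \<omega> - y))\<^sup>2)) \<longlonglongrightarrow> ennreal ((norm (ubar \<omega> - y))\<^sup>2)"
        by (intro tendsto_ennrealI tendsto_intros) auto
      then show ?case by (intro lim_imp_Liminf[symmetric]) auto
    qed
  qed
  \<comment> \<open>Fatou's lemma carries the uniform moment bound of the iterates over to their
    limit.\<close>
  also have "\<dots> \<le> liminf (\<lambda>k. \<integral>\<^sup>+\<omega>. ennreal ((norm (u k \<omega> - y))\<^sup>2) \<partial>M)"
    by (rule nn_integral_liminf) measurable
  also have "\<dots> \<le> ennreal c"
  proof (rule Liminf_le)
    show "\<forall>\<^sub>F k in sequentially. (\<integral>\<^sup>+\<omega>. ennreal ((norm (u k \<omega> - y))\<^sup>2) \<partial>M) \<le> ennreal c"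
      using nn_integral_eq_integral[OF u_dist_sq[of _ y]] c by (simp add: ennreal_leI)
  qed simp
  finally show ?thesis by (intro integrableI_bounded) (auto intro: le_less_trans)
qed

text \<open>The increments \<open>X\<close> only have a square-integrable sum, so the iterates themselves are not
  obviously dominated. For every \<open>L > 0\<close> the bound \<open>2 N \<le> L + N\<^sup>2 / L\<close> splits the
  error into a dominated part and a part of expectation at most a constant divided by \<open>L\<close>.\<close>

lemma u_error_tendsto: "(\<lambda>k. integral\<^sup>L M (\<lambda>\<omega>. (norm (u k \<omega> - ubar \<omega>))\<^sup>2)) \<longlonglongrightarrow> 0"
  and u_error_integrable: "integrable M (\<lambda>\<omega>. (norm (u k \<omega> - ubar \<omega>))\<^sup>2)"
proof -
  obtain y where y: "y \<in> S" using S by auto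
  define f where "f n \<omega> = (norm (u n \<omega> - ubar \<omega>))\<^sup>2" for n \<omega>
  define N where "N n \<omega> = (\<Sum>k<n. X y k \<omega>)" for n \<omega>
  \<comment> \<open>Summing the descent inequality and dropping the drift bounds |u n - y|^2 by the
    initial error, the martingale \<open>N n\<close> and the total of \<open>r\<close>.
    \<open>G\<close> is twice this bound without the martingale, plus the share of the
    limit.\<close>
  define G where "G \<omega> = 2 * ((norm (u0 - y))\<^sup>2 + (\<Sum>k. r k \<omega>)) + 2 * (norm (ubar \<omega> - y))\<^sup>2" for \<omega>
  interpret X: orthogonal_increments M Fl "X y" by (rule X_orthogonal[OF y])
  have [measurable]: "f n \<in> borel_measurable M" "N n \<in> borel_measurable M" for n
    unfolding f_def[abs_def] N_def[abs_def] by measurable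
  have N_sq: "integrable M (\<lambda>\<omega>. (N n \<omega>)\<^sup>2)" for n
    using X.S_sq(1)[of n] unfolding X.S_def N_def .
  define c where "c = (\<Sum>k. integral\<^sup>L M (\<lambda>\<omega>. (X y k \<omega>)\<^sup>2))"
  have N_bound: "integral\<^sup>L M (\<lambda>\<omega>. (N n \<omega>)\<^sup>2) \<le> c" for n
    using X.S_sq(2)[of n] sum_le_suminf[OF X_sq_summable[OF y], of "{..<n}"]
    unfolding X.S_def N_def c_def by simp
  have sq: "(norm (v - w))\<^sup>2 \<le> 2 * (norm (v - y))\<^sup>2 + 2 * (norm (w - y))\<^sup>2" for v w
  proof -
    have "(norm (v - w))\<^sup>2 \<le> (norm (v - y) + norm (w - y))\<^sup>2"
      using norm_triangle_ineq4[of "v - y" "w - y"] by (intro power_mono) auto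
    also have "\<dots> \<le> 2 * (norm (v - y))\<^sup>2 + 2 * (norm (w - y))\<^sup>2"
      using sum_squares_bound[of "norm (v - y)" "norm (w - y)"]
      by (simp add: power2_eq_square algebra_simps)
    finally show ?thesis .
  qed
  have f_int: "integrable M (f n)" for n
    by (rule Bochner_Integration.integrable_bound
        [of _ "\<lambda>\<omega>. 2 * (norm (u n \<omega> - y))\<^sup>2 + 2 * (norm (ubar \<omega> - y))\<^sup>2"])
      (use u_dist_sq[of n y] ubar_sq[OF y] sq in \<open>auto simp: f_def\<close>)
  then show "integrable M (\<lambda>\<omega>. (norm (u k \<omega> - ubar \<omega>))\<^sup>2)" unfolding f_def .
  have G_int: "integrable M G"
    unfolding G_def[abs_def] using ubar_sq[OF y] AE_summable_nonneg(2)[OF r_integrable r_nonneg r_summable[OF y]]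
    by auto
  have f_le: "AE \<omega> in M. \<forall>n. f n \<omega> \<le> G \<omega> + 2 * N n \<omega>"
    using AE_summable_nonneg(1)[OF r_integrable r_nonneg r_summable[OF y]] AE_space
  proof eventually_elim
    case (elim \<omega>)
    have "(norm (u n \<omega> - y))\<^sup>2 \<le> (norm (u0 - y))\<^sup>2 + N n \<omega> + (\<Sum>k<n. r k \<omega>)" for n
    proof (induction n)
      case (Suc n)
      have "0 \<le> 2 * \<alpha> n * (\<mu> * infdist (h n \<omega>) S powr p)"
        using \<alpha>(1)[of n] sharp(2) by simp
      moreover have "N (Suc n) \<omega> = N n \<omega> + X y n \<omega>"
        "(\<Sum>k<Suc n. r k \<omega>) = (\<Sum>k<n. r k \<omega>) + r n \<omega>"
        by (simp_all add: N_def)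
      ultimately show ?case using Suc descent[OF y elim(2), of n] by linarith
    qed (simp add: N_def init elim)
    moreover have "(\<Sum>k<n. r k \<omega>) \<le> (\<Sum>k. r k \<omega>)" for n
      by (rule sum_le_suminf[OF elim(1)]) (auto simp: r_nonneg)
    ultimately have le: "(norm (u n \<omega> - y))\<^sup>2 \<le> (norm (u0 - y))\<^sup>2 + N n \<omega> + (\<Sum>k. r k \<omega>)" for n
      by (meson add_left_mono order_trans)
    show ?case
    proof
      show "f n \<omega> \<le> G \<omega> + 2 * N n \<omega>" for n
        using le[of n] sq[of "u n \<omega>" "ubar \<omega>"] by (simp add: f_def G_def)
    qed
  qed
  have f_lim: "AE \<omega> in M. (\<lambda>n. f n \<omega>) \<longlonglongrightarrow> 0"
    using AE_tendsto_ubar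
  proof eventually_elim
    case (elim \<omega>)
    then have "(\<lambda>n. f n \<omega>) \<longlonglongrightarrow> (norm (ubar \<omega> - ubar \<omega>))\<^sup>2"
      unfolding f_def by (intro tendsto_intros) auto
    then show ?case by simp
  qed
  have split: "\<exists>n0. \<forall>n\<ge>n0. integral\<^sup>L M (f n) < e + c / L" if "L > 0" "e > 0" for L e
  proof -
    \<comment> \<open>The excess of the error over \<open>(N n \<omega>)\<^sup>2 / L\<close> is
      dominated by \<open>\<bar>G \<omega>\<bar> + L\<close>, while the part removed has expectation
      at most \<open>c / L\<close> for every \<open>n\<close>.\<close>
    define g where "g n \<omega> = max 0 (f n \<omega> - (N n \<omega>)\<^sup>2 / L)" for n \<omega>
    have [measurable]: "g n \<in> borel_measurable M" for n unfolding g_def[abs_def] by measurable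
    have g_le_f: "0 \<le> g n \<omega>" "g n \<omega> \<le> f n \<omega>" for n \<omega>
      using \<open>L > 0\<close> by (auto simp: g_def f_def)
    have g_int: "integrable M (g n)" for n
      by (rule Bochner_Integration.integrable_bound[OF f_int[of n]])
        (use g_le_f order_trans in \<open>auto simp: f_def\<close>)
    have "(\<lambda>n. integral\<^sup>L M (g n)) \<longlonglongrightarrow> integral\<^sup>L M (\<lambda>_. 0)"
    proof (rule integral_dominated_convergence)
      show "integrable M (\<lambda>\<omega>. \<bar>G \<omega>\<bar> + L)" using G_int by simp
      show "AE \<omega> in M. (\<lambda>n. g n \<omega>) \<longlonglongrightarrow> 0"
        using f_lim
      proof eventually_elim
        case (elim \<omega>)
        show ?case by (rule tendsto_sandwich[OF _ _ tendsto_const elim]) (auto simp: g_le_f)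
      qed
      show "AE \<omega> in M. norm (g n \<omega>) \<le> \<bar>G \<omega>\<bar> + L" for n
        using f_le
      proof eventually_elim
        case (elim \<omega>)
        have "0 \<le> (N n \<omega> - L)\<^sup>2 / L" using \<open>L > 0\<close> by simp
        also have "\<dots> = (N n \<omega>)\<^sup>2 / L - 2 * N n \<omega> + L"
          using \<open>L > 0\<close> by (simp add: power2_eq_square field_simps)
        finally show ?case using elim[rule_format, of n] \<open>L > 0\<close> by (auto simp: g_def)
      qed
    qed measurable
    then have "(\<lambda>n. integral\<^sup>L M (g n)) \<longlonglongrightarrow> 0" by simp
    from LIMSEQ_D[OF this \<open>e > 0\<close>] obtain n0 where
      n0: "\<And>n. n \<ge> n0 \<Longrightarrow> \<bar>integral\<^sup>L M (g n)\<bar> < e" by auto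
    have "integral\<^sup>L M (f n) < e + c / L" if "n \<ge> n0" for n
    proof -
      have "integral\<^sup>L M (f n) \<le> integral\<^sup>L M (\<lambda>\<omega>. g n \<omega> + (N n \<omega>)\<^sup>2 / L)"
      proof (rule integral_mono[OF f_int])
        show "integrable M (\<lambda>\<omega>. g n \<omega> + (N n \<omega>)\<^sup>2 / L)" using g_int N_sq by simp
        show "f n \<omega> \<le> g n \<omega> + (N n \<omega>)\<^sup>2 / L" for \<omega> unfolding g_def by linarith
      qed
      also have "\<dots> = integral\<^sup>L M (g n) + integral\<^sup>L M (\<lambda>\<omega>. (N n \<omega>)\<^sup>2) / L"
        using g_int N_sq by simp
      finally have "integral\<^sup>L M (f n) \<le> integral\<^sup>L M (g n) + integral\<^sup>L M (\<lambda>\<omega>. (N n \<omega>)\<^sup>2) / L" .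
      moreover have "integral\<^sup>L M (\<lambda>\<omega>. (N n \<omega>)\<^sup>2) / L \<le> c / L"
        using \<open>L > 0\<close> by (intro divide_right_mono N_bound) simp
      ultimately show ?thesis using n0[OF that] by linarith
    qed
    then show ?thesis by blast
  qed
  have "(\<lambda>n. integral\<^sup>L M (f n)) \<longlonglongrightarrow> 0"
  proof (rule LIMSEQ_I)
    fix e :: real assume "e > 0"
    have "c \<ge> 0" using N_bound[of 0] by (simp add: N_def)
    \<comment> \<open>Large enough for \<open>c / L\<close> to stay below half of \<open>e\<close>;
      the added 1 keeps \<open>L\<close> positive when \<open>c\<close> is zero.\<close>
    define L where "L = (2 * c + 1) / e"
    have "L > 0" using \<open>e > 0\<close> \<open>c \<ge> 0\<close> by (simp add: L_def)
    moreover have "2 * c < e * L" using \<open>e > 0\<close> by (simp add: L_def)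
    ultimately have L: "L > 0" "c / L < e / 2" by (simp_all add: divide_simps mult.commute)
    from split[OF L(1), of "e / 2"] \<open>e > 0\<close> obtain n0 where
      n0: "\<And>n. n \<ge> n0 \<Longrightarrow> integral\<^sup>L M (f n) < e / 2 + c / L" by auto
    have nonneg: "integral\<^sup>L M (f n) \<ge> 0" for n by (simp add: f_def)
    have "norm (integral\<^sup>L M (f n) - 0) < e" if "n \<ge> n0" for n
      using L(2) nonneg[of n] n0[OF that] unfolding real_norm_def by linarith
    then show "\<exists>n0. \<forall>n\<ge>n0. norm (integral\<^sup>L M (f n) - 0) < e" by blast
  qed
  then show "(\<lambda>k. integral\<^sup>L M (\<lambda>\<omega>. (norm (u k \<omega> - ubar \<omega>))\<^sup>2)) \<longlonglongrightarrow> 0" unfolding f_def .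
qed

text \<open>Both claims follow from \<open>h_dist_le\<close> with the random point
  \<open>ubar \<omega>\<close> in place of \<open>y\<close>.\<close>

lemma h_error_integrable: "integrable M (\<lambda>\<omega>. (norm (h k \<omega> - ubar \<omega>))\<^sup>2)"
  and h_error_le: "integral\<^sup>L M (\<lambda>\<omega>. (norm (h k \<omega> - ubar \<omega>))\<^sup>2)
    \<le> 2 * integral\<^sup>L M (\<lambda>\<omega>. (norm (u k \<omega> - ubar \<omega>))\<^sup>2)
      + 2 * ((\<alpha> k)\<^sup>2 * integral\<^sup>L M (\<lambda>\<omega>. (B k \<omega>)\<^sup>2))"
proof -
  let ?b = "\<lambda>\<omega>. 2 * (norm (u k \<omega> - ubar \<omega>))\<^sup>2 + 2 * ((\<alpha> k)\<^sup>2 * (B k \<omega>)\<^sup>2)"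
  have int: "integrable M ?b" using u_error_integrable[of k] B_sq[of k] by simp
  have le: "(norm (h k \<omega> - ubar \<omega>))\<^sup>2 \<le> ?b \<omega>" if "\<omega> \<in> space M" for \<omega>
    by (rule h_dist_le[OF that])
  show h: "integrable M (\<lambda>\<omega>. (norm (h k \<omega> - ubar \<omega>))\<^sup>2)"
    by (rule Bochner_Integration.integrable_bound[OF int]) (use le in auto)
  have "integral\<^sup>L M (\<lambda>\<omega>. (norm (h k \<omega> - ubar \<omega>))\<^sup>2) \<le> integral\<^sup>L M ?b"
    by (rule integral_mono[OF h int le])
  also have "\<dots> = 2 * integral\<^sup>L M (\<lambda>\<omega>. (norm (u k \<omega> - ubar \<omega>))\<^sup>2)
      + 2 * ((\<alpha> k)\<^sup>2 * integral\<^sup>L M (\<lambda>\<omega>. (B k \<omega>)\<^sup>2))"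
    using u_error_integrable[of k] B_sq[of k] by simp
  finally show "integral\<^sup>L M (\<lambda>\<omega>. (norm (h k \<omega> - ubar \<omega>))\<^sup>2)
    \<le> 2 * integral\<^sup>L M (\<lambda>\<omega>. (norm (u k \<omega> - ubar \<omega>))\<^sup>2)
      + 2 * ((\<alpha> k)\<^sup>2 * integral\<^sup>L M (\<lambda>\<omega>. (B k \<omega>)\<^sup>2))" .
qed

lemma h_error_tendsto: "(\<lambda>k. integral\<^sup>L M (\<lambda>\<omega>. (norm (h k \<omega> - ubar \<omega>))\<^sup>2)) \<longlonglongrightarrow> 0"
proof -
  obtain c where c: "\<And>k. integral\<^sup>L M (\<lambda>\<omega>. (B k \<omega>)\<^sup>2) \<le> c" using moments_bounded S by blast
  have "(\<lambda>k. 2 * integral\<^sup>L M (\<lambda>\<omega>. (norm (u k \<omega> - ubar \<omega>))\<^sup>2) + 2 * ((\<alpha> k)\<^sup>2 * c))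
    \<longlonglongrightarrow> 2 * 0 + 2 * (0 * c)"
    by (intro tendsto_intros u_error_tendsto summable_LIMSEQ_zero \<alpha>(3))
  then have lim: "(\<lambda>k. 2 * integral\<^sup>L M (\<lambda>\<omega>. (norm (u k \<omega> - ubar \<omega>))\<^sup>2) + 2 * ((\<alpha> k)\<^sup>2 * c)) \<longlonglongrightarrow> 0"
    by simp
  show ?thesis
  proof (rule tendsto_sandwich[OF _ _ tendsto_const lim])
    show "\<forall>\<^sub>F k in sequentially. integral\<^sup>L M (\<lambda>\<omega>. (norm (h k \<omega> - ubar \<omega>))\<^sup>2)
      \<le> 2 * integral\<^sup>L M (\<lambda>\<omega>. (norm (u k \<omega> - ubar \<omega>))\<^sup>2) + 2 * ((\<alpha> k)\<^sup>2 * c)"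
    proof (intro always_eventually allI order_trans[OF h_error_le] add_left_mono)
      show "2 * ((\<alpha> k)\<^sup>2 * integral\<^sup>L M (\<lambda>\<omega>. (B k \<omega>)\<^sup>2)) \<le> 2 * ((\<alpha> k)\<^sup>2 * c)" for k
        using c[of k] by (intro mult_left_mono) auto
    qed
  qed simp
qed

lemma second_moments_bounded:
  "bounded (range (\<lambda>k. integral\<^sup>L M (\<lambda>\<omega>. (norm (u k \<omega>))\<^sup>2)))"
  "bounded (range (\<lambda>k. integral\<^sup>L M (\<lambda>\<omega>. (norm (h k \<omega>))\<^sup>2)))"
proof -
  obtain y where y: "y \<in> S" using S by auto
  then obtain c where c: "\<And>k. integral\<^sup>L M (\<lambda>\<omega>. (norm (u k \<omega> - y))\<^sup>2) \<le> c"
    "\<And>k. integral\<^sup>L M (\<lambda>\<omega>. (norm (h k \<omega> - y))\<^sup>2) \<le> c" using moments_bounded by blast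
  have le: "\<bar>integral\<^sup>L M (\<lambda>\<omega>. (norm (f \<omega>))\<^sup>2)\<bar> \<le> 2 * c + 2 * (norm y)\<^sup>2"
    if f: "integrable M (\<lambda>\<omega>. (norm (f \<omega>))\<^sup>2)" "integrable M (\<lambda>\<omega>. (norm (f \<omega> - y))\<^sup>2)"
      and fc: "integral\<^sup>L M (\<lambda>\<omega>. (norm (f \<omega> - y))\<^sup>2) \<le> c" for f :: "'w \<Rightarrow> 'a"
  proof -
    have "(norm v)\<^sup>2 \<le> 2 * (norm (v - y))\<^sup>2 + 2 * (norm y)\<^sup>2" for v
    proof -
      have "(norm v)\<^sup>2 \<le> (norm (v - y) + norm y)\<^sup>2"
        using norm_triangle_sub[of v y] by (intro power_mono) (auto simp: add.commute)
      also have "\<dots> \<le> 2 * (norm (v - y))\<^sup>2 + 2 * (norm y)\<^sup>2"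
        using sum_squares_bound[of "norm (v - y)" "norm y"]
        by (simp add: power2_eq_square algebra_simps)
      finally show ?thesis .
    qed
    then have "integral\<^sup>L M (\<lambda>\<omega>. (norm (f \<omega>))\<^sup>2)
      \<le> integral\<^sup>L M (\<lambda>\<omega>. 2 * (norm (f \<omega> - y))\<^sup>2 + 2 * (norm y)\<^sup>2)"
      using f by (intro integral_mono) auto
    also have "\<dots> = 2 * integral\<^sup>L M (\<lambda>\<omega>. (norm (f \<omega> - y))\<^sup>2) + 2 * (norm y)\<^sup>2"
      using f by (simp add: prob_space)
    finally show ?thesis using fc by simp
  qed
  show "bounded (range (\<lambda>k. integral\<^sup>L M (\<lambda>\<omega>. (norm (u k \<omega>))\<^sup>2)))"
    using le[OF iterates_sq(1) u_dist_sq c(1)]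
    by (intro boundedI[of _ "2 * c + 2 * (norm y)\<^sup>2"]) auto
  show "bounded (range (\<lambda>k. integral\<^sup>L M (\<lambda>\<omega>. (norm (h k \<omega>))\<^sup>2)))"
    using le[OF iterates_sq(2) h_dist_sq c(2)]
    by (intro boundedI[of _ "2 * c + 2 * (norm y)\<^sup>2"]) auto
qed

end

section \<open>Independent samples\<close>

lemma subalgebra_vimage_algebra:
  assumes "X \<in> measurable M N"
  shows "subalgebra M (vimage_algebra (space M) X N)"
  unfolding subalgebra_def sets_vimage_algebra
  using measurable_sets[OF assms] by (auto intro!: sets.sigma_sets_subset)

text \<open>The freezing principle: agreement on rectangles identifies the joint law with the
  product law, and Fubini then integrates over \<open>Y\<close> while \<open>X\<close> is held
  fixed. Leaving the space \<open>N\<close> general permits \<open>X\<close> to be the identity into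
  a coarser sigma-algebra.\<close>

lemma (in prob_space) integral_indep_eq_0:
  fixes f :: "'b \<times> 'c \<Rightarrow> real"
  assumes [measurable]: "X \<in> measurable M N" "Y \<in> measurable M L" "f \<in> borel_measurable (N \<Otimes>\<^sub>M L)"
    and indep: "\<And>A B. \<lbrakk>A \<in> sets N; B \<in> sets L\<rbrakk> \<Longrightarrow> prob (X -` A \<inter> (Y -` B \<inter> space M))
      = prob (X -` A \<inter> space M) * prob (Y -` B \<inter> space M)"
    and int: "integrable M (\<lambda>\<omega>. f (X \<omega>, Y \<omega>))"
    and zero: "\<And>x. x \<in> space N \<Longrightarrow> (\<integral>y. f (x, y) \<partial>distr M L Y) = 0"
  shows "(\<integral>\<omega>. f (X \<omega>, Y \<omega>) \<partial>M) = 0"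
proof -
  interpret PX: prob_space "distr M N X" by (rule prob_space_distr) measurable
  interpret PY: prob_space "distr M L Y" by (rule prob_space_distr) measurable
  interpret P: pair_sigma_finite "distr M N X" "distr M L Y" ..
  have eq: "distr M N X \<Otimes>\<^sub>M distr M L Y = distr M (N \<Otimes>\<^sub>M L) (\<lambda>\<omega>. (X \<omega>, Y \<omega>))"
  proof (rule pair_measure_eqI)
    fix A B assume "A \<in> sets (distr M N X)" "B \<in> sets (distr M L Y)"
    then have AB [measurable]: "A \<in> sets N" "B \<in> sets L" by auto
    have "(\<lambda>\<omega>. (X \<omega>, Y \<omega>)) -` (A \<times> B) \<inter> space M = X -` A \<inter> (Y -` B \<inter> space M)" by auto
    then show "emeasure (distr M N X) A * emeasure (distr M L Y) B
        = emeasure (distr M (N \<Otimes>\<^sub>M L) (\<lambda>\<omega>. (X \<omega>, Y \<omega>))) (A \<times> B)"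
      by (simp add: emeasure_distr emeasure_eq_measure indep[OF AB] ennreal_mult)
  qed (simp_all add: PX.sigma_finite_measure_axioms PY.sigma_finite_measure_axioms cong: sets_pair_measure_cong)
  have "(\<integral>\<omega>. f (X \<omega>, Y \<omega>) \<partial>M) = integral\<^sup>L (distr M N X \<Otimes>\<^sub>M distr M L Y) f"
    unfolding eq by (subst integral_distr) auto
  also have "\<dots> = (\<integral>x. (\<integral>y. f (x, y) \<partial>distr M L Y) \<partial>distr M N X)"
    by (rule P.integral_fst'[symmetric]) (use int in \<open>simp add: eq integrable_distr_eq\<close>)
  also have "\<dots> = (\<integral>x. 0 \<partial>distr M N X)"
    by (rule Bochner_Integration.integral_cong) (simp_all add: zero)
  finally show ?thesis by simp
qed

text \<open>The sigma-algebra of the samples with index below \<open>k\<close>: it determines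
  \<open>h k\<close> but excludes sample \<open>k\<close>. Bundling the samples into one map to a
  product space matches the form in which independence of disjoint blocks is available.\<close>

definition history :: "'w measure \<Rightarrow> (nat \<Rightarrow> 'w \<Rightarrow> 'b::topological_space) \<Rightarrow> nat \<Rightarrow> 'w measure" where
  "history M X k = vimage_algebra (space M) (\<lambda>\<omega>. \<lambda>i\<in>{..<k}. X i \<omega>) (PiM {..<k} (\<lambda>_. borel))"

lemma space_history [simp]: "space (history M X k) = space M"
  by (simp add: history_def)

lemma measurable_history:
  assumes "i < k"
  shows "X i \<in> borel_measurable (history M X k)"
proof -
  have W: "(\<lambda>\<omega>. \<lambda>i\<in>{..<k}. X i \<omega>) \<in> measurable (history M X k) (PiM {..<k} (\<lambda>_. borel))"
    unfolding history_def by (rule measurable_vimage_algebra1) (auto simp: space_PiM)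
  have "(\<lambda>\<omega>. (\<lambda>i\<in>{..<k}. X i \<omega>) i) \<in> borel_measurable (history M X k)"
    using measurable_compose[OF W measurable_component_singleton[of i]] assms by simp
  then show ?thesis using assms by simp
qed

lemma subalgebra_history:
  assumes "\<And>i. X i \<in> borel_measurable M"
  shows "subalgebra M (history M X k)"
  unfolding history_def
  by (rule subalgebra_vimage_algebra) (intro measurable_restrict assms)

lemma subalgebra_history_Suc: "subalgebra (history M X (Suc k)) (history M X k)"
proof -
  have "subalgebra (history M X (Suc k))
    (vimage_algebra (space (history M X (Suc k))) (\<lambda>\<omega>. \<lambda>i\<in>{..<k}. X i \<omega>) (PiM {..<k} (\<lambda>_. borel)))"
    by (rule subalgebra_vimage_algebra) (intro measurable_restrict measurable_history, simp)
  then show ?thesis by (simp add: history_def)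
qed

text \<open>The index blocks below \<open>k\<close> and \<open>{k}\<close> are disjoint, hence
  independent. The second block is a product over a singleton, so an event of sample
  \<open>k\<close> is rewritten through its only coordinate.\<close>

lemma (in prob_space) indep_history:
  assumes indep: "indep_vars (\<lambda>_. borel) X UNIV"
    and A: "A \<in> sets (history M X k)" and B: "B \<in> sets borel"
  shows "prob (A \<inter> (X k -` B \<inter> space M)) = prob A * prob (X k -` B \<inter> space M)"
proof -
  let ?V = "\<lambda>\<omega>. \<lambda>i\<in>{k}. X i \<omega>"
  have "indep_var (PiM {..<k} (\<lambda>_. borel)) (\<lambda>\<omega>. \<lambda>i\<in>{..<k}. X i \<omega>) (PiM {k} (\<lambda>_. borel)) ?V"
    by (rule indep_var_restrict[OF indep]) auto
  then have ind: "indep_set (sets (history M X k))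
      (sigma_sets (space M) {?V -` A \<inter> space M |A. A \<in> sets (PiM {k} (\<lambda>_. borel))})"
    by (simp add: indep_var_eq history_def sets_vimage_algebra)
  have "X k -` B \<inter> space M = ?V -` ((\<lambda>x. x k) -` B \<inter> space (PiM {k} (\<lambda>_. borel))) \<inter> space M"
    by (auto simp: space_PiM)
  moreover have "(\<lambda>x. x k) -` B \<inter> space (PiM {k} (\<lambda>_. borel)) \<in> sets (PiM {k} (\<lambda>_. borel))"
    using measurable_component_singleton[of k "{k}" "\<lambda>_. borel"] B by (intro measurable_sets) auto
  ultimately have "X k -` B \<inter> space M
      \<in> sigma_sets (space M) {?V -` A \<inter> space M |A. A \<in> sets (PiM {k} (\<lambda>_. borel))}"
    by (intro sigma_sets.Basic) blast
  with ind show ?thesis using A by (intro indep_setD)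
qed

text \<open>The weight \<open>f (Y \<omega>)\<close> is measurable for the conditioning
  sigma-algebra, so \<open>g\<close> may be replaced by its conditional expectation. With extended
  nonnegative values, unbounded weights such as |v - y|^2 are covered.\<close>

lemma (in prob_space) nn_cond_exp_le_integral:
  assumes [measurable]: "Y \<in> borel_measurable M" "g \<in> borel_measurable M" "f \<in> borel_measurable borel"
    and le: "AE \<omega> in M. nn_cond_exp M (sigma_of M Y) g \<omega> \<le> c"
  shows "(\<integral>\<^sup>+\<omega>. f (Y \<omega>) * g \<omega> \<partial>M) \<le> c * (\<integral>\<^sup>+\<omega>. f (Y \<omega>) \<partial>M)"
proof -
  interpret G: finite_measure_subalgebra M "sigma_of M Y"
    by unfold_locales (auto simp: sigma_of_def intro!: subalgebra_vimage_algebra)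
  have "Y \<in> borel_measurable (sigma_of M Y)"
    unfolding sigma_of_def by (rule measurable_vimage_algebra1) simp
  then have "(\<lambda>\<omega>. f (Y \<omega>)) \<in> borel_measurable (sigma_of M Y)"
    by (rule measurable_compose) measurable
  then have "(\<integral>\<^sup>+\<omega>. f (Y \<omega>) * g \<omega> \<partial>M) = (\<integral>\<^sup>+\<omega>. f (Y \<omega>) * nn_cond_exp M (sigma_of M Y) g \<omega> \<partial>M)"
    by (rule G.nn_cond_exp_intg[symmetric]) fact
  also have "\<dots> \<le> (\<integral>\<^sup>+\<omega>. c * f (Y \<omega>) \<partial>M)"
    by (intro nn_integral_mono_AE) (use le in \<open>eventually_elim, metis mult.commute mult_left_mono zero_le\<close>)
  also have "\<dots> = c * (\<integral>\<^sup>+\<omega>. f (Y \<omega>) \<partial>M)"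
    by (rule nn_integral_cmult) measurable
  finally show ?thesis .
qed

section \<open>From independent samples to the abstract process\<close>

theorem theorem3p3:
  fixes M :: "'w measure"
    and U :: "(real ^ 'm) set"
    and \<Phi> :: "real ^ 'm \<Rightarrow> real ^ 'd \<Rightarrow> real ^ 'm"
    and F :: "real ^ 'm \<Rightarrow> real ^ 'm"
    and \<xi> :: "'w \<Rightarrow> real ^ 'd"
    and \<xi>s :: "nat \<Rightarrow> 'w \<Rightarrow> real ^ 'd"
    and u h :: "nat \<Rightarrow> 'w \<Rightarrow> real ^ 'm"
    and u0 h0 :: "real ^ 'm"
    and \<alpha> :: "nat \<Rightarrow> real"
    and \<sigma> C D p \<mu> :: real
  assumes prob: "prob_space M"
    and U: "U \<noteq> {}" "closed U" "convex U"
    and \<Phi>_meas: "(\<lambda>(v, x). \<Phi> v x) \<in> borel_measurable (restrict_space borel U \<Otimes>\<^sub>M borel)"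
    and \<xi>_meas: "\<xi> \<in> borel_measurable M"
    and F_eq: "\<And>v. v \<in> U \<Longrightarrow> has_bochner_integral M (\<lambda>\<omega>. \<Phi> v (\<xi> \<omega>)) (F v)"
    and sol: "vi_solutions U F \<noteq> {}" "closed (vi_solutions U F)"
    and samples_indep: "prob_space.indep_vars M (\<lambda>_. borel) \<xi>s UNIV"
    and samples_distr: "\<And>k. distr M borel (\<xi>s k) = distr M borel \<xi>"
    and init: "u0 \<in> U" "h0 \<in> U"
    and popov: "\<And>\<omega>. \<omega> \<in> space M \<Longrightarrow>
        popov_path U \<Phi> \<alpha> u0 h0 (\<lambda>k. \<xi>s k \<omega>) (\<lambda>k. u k \<omega>) (\<lambda>k. h k \<omega>)"
    and \<sigma>: "\<sigma> > 0"
    and unbiased: "\<And>k. AE \<omega> in M.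
        vec_cond_exp M (sigma_of M (h k)) (\<lambda>\<omega>. \<Phi> (h k \<omega>) (\<xi>s k \<omega>) - F (h k \<omega>)) \<omega> = 0"
    and variance: "\<And>k. AE \<omega> in M.
        nn_cond_exp M (sigma_of M (h k))
          (\<lambda>\<omega>. ennreal ((norm (\<Phi> (h k \<omega>) (\<xi>s k \<omega>) - F (h k \<omega>)))\<^sup>2)) \<omega> \<le> ennreal (\<sigma>\<^sup>2)"
    and growth: "C \<ge> 0" "D \<ge> 0" "\<And>v. v \<in> U \<Longrightarrow> norm (F v) \<le> C * norm v + D"
    and sharp: "p > 0" "\<mu> > 0" "quasi_sharp p \<mu> U (vi_solutions U F) F"
    and steps: "\<And>k. \<alpha> k > 0"
      "filterlim (\<lambda>n. \<Sum>k<n. \<alpha> k) at_top sequentially"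
      "summable (\<lambda>k. (\<alpha> k)\<^sup>2)"
  shows "(\<exists>ubar \<in> borel_measurable M.
            (\<forall>\<omega>\<in>space M. ubar \<omega> \<in> U) \<and>
            (AE \<omega> in M. (\<lambda>k. u k \<omega>) \<longlonglongrightarrow> ubar \<omega>) \<and>
            (AE \<omega> in M. (\<lambda>k. h k \<omega>) \<longlonglongrightarrow> ubar \<omega>) \<and>
            measure M {\<omega> \<in> space M. ubar \<omega> \<in> vi_solutions U F} = 1 \<and>
            (bounded (vi_solutions U F) \<longrightarrow>
              (\<forall>k. integrable M (\<lambda>\<omega>. (norm (u k \<omega> - ubar \<omega>))\<^sup>2) \<and>
                   integrable M (\<lambda>\<omega>. (norm (h k \<omega> - ubar \<omega>))\<^sup>2)) \<and>
              (\<lambda>k. integral\<^sup>L M (\<lambda>\<omega>. (norm (u k \<omega> - ubar \<omega>))\<^sup>2)) \<longlonglongrightarrow> 0 \<and>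
              (\<lambda>k. integral\<^sup>L M (\<lambda>\<omega>. (norm (h k \<omega> - ubar \<omega>))\<^sup>2)) \<longlonglongrightarrow> 0)) \<and>
         (\<forall>k. integrable M (\<lambda>\<omega>. (norm (u k \<omega>))\<^sup>2) \<and> integrable M (\<lambda>\<omega>. (norm (h k \<omega>))\<^sup>2)) \<and>
         bounded (range (\<lambda>k. integral\<^sup>L M (\<lambda>\<omega>. (norm (u k \<omega>))\<^sup>2))) \<and>
         bounded (range (\<lambda>k. integral\<^sup>L M (\<lambda>\<omega>. (norm (h k \<omega>))\<^sup>2)))"
proof -
  interpret prob_space M by (rule prob)
  let ?S = "vi_solutions U F"
  let ?Fl = "history M \<xi>s"
  define Q where "Q k \<omega> = \<Phi> (h k \<omega>) (\<xi>s k \<omega>)" for k \<omega>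
  \<comment> \<open>Precomposing with the projection extends the data measurably from \<open>U\<close> to the whole space.\<close>
  define \<Phi>' where "\<Phi>' v x = \<Phi> (closest_point U v) x" for v x
  define F' where "F' v = F (closest_point U v)" for v
  have P_in: "closest_point U v \<in> U" for v by (rule closest_point_in_set[OF U(2,1)])
  have P_meas [measurable]: "closest_point U \<in> borel_measurable borel"
    by (intro borel_measurable_continuous_onI continuous_on_closest_point U)
  have \<Phi>'_meas [measurable]: "(\<lambda>(v, x). \<Phi>' v x) \<in> borel_measurable (borel \<Otimes>\<^sub>M borel)"
  proof -
    have "(\<lambda>(v, x). (closest_point U v, x)) \<in> measurable (borel \<Otimes>\<^sub>M borel) (restrict_space borel U \<Otimes>\<^sub>M borel)"
      unfolding split_beta' by (intro measurable_Pair measurable_restrict_space2) (auto simp: P_in)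
    from measurable_compose[OF this \<Phi>_meas] show ?thesis
      by (simp add: \<Phi>'_def split_beta')
  qed
  have F'_int: "has_bochner_integral M (\<lambda>\<omega>. \<Phi>' v (\<xi> \<omega>)) (F' v)" for v
    unfolding \<Phi>'_def F'_def by (rule F_eq[OF P_in])
  \<comment> \<open>\<open>F\<close> is specified on \<open>U\<close> pointwise, as an expectation.
    Its extension is a parameter integral of a jointly measurable function, and this yields
    measurability.\<close>
  have F'_meas [measurable]: "F' \<in> borel_measurable borel"
  proof -
    have "F' = (\<lambda>v. integral\<^sup>L M (\<lambda>\<omega>. \<Phi>' v (\<xi> \<omega>)))"
      by (intro ext has_bochner_integral_integral_eq[symmetric] F'_int)
    also have "\<dots> \<in> borel_measurable borel"
      using \<xi>_meas by measurable
    finally show ?thesis .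
  qed
  have \<xi>s_meas [measurable]: "\<xi>s k \<in> borel_measurable M" for k
    using samples_indep by (auto simp: indep_vars_def)
  note path = popov[unfolded popov_path_def]
  have u_Suc: "u (Suc k) \<omega> = closest_point U (u k \<omega> - \<alpha> k *\<^sub>R Q k \<omega>)"
    and h_Suc: "h (Suc k) \<omega> = closest_point U (u (Suc k) \<omega> - \<alpha> (Suc k) *\<^sub>R Q k \<omega>)"
    if "\<omega> \<in> space M" for k \<omega>
    using path[OF that] by (auto simp: Q_def)
  have h_in: "h k \<omega> \<in> U" if "\<omega> \<in> space M" for k \<omega>
    using path[OF that] init h_Suc[OF that] P_in by (cases k) auto
  have P_h: "closest_point U (h k \<omega>) = h k \<omega>" if "\<omega> \<in> space M" for k \<omega>
    by (rule closest_point_self[OF h_in[OF that]])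
  have Q_eq: "Q k \<omega> = \<Phi>' (h k \<omega>) (\<xi>s k \<omega>)" and F_eq': "F (h k \<omega>) = F' (h k \<omega>)"
    if "\<omega> \<in> space M" for k \<omega>
    by (simp_all add: Q_def \<Phi>'_def F'_def P_h that)
  \<comment> \<open>The direction uses sample \<open>k\<close>, so it is known only one step later
    than \<open>h k\<close>. The premise on \<open>h k\<close> makes the claim usable inside the
    induction below.\<close>
  have Q_step: "Q k \<in> borel_measurable (?Fl (Suc k))" if "h k \<in> borel_measurable (?Fl k)" for k
  proof -
    have [measurable]: "h k \<in> borel_measurable (?Fl (Suc k))" "\<xi>s k \<in> borel_measurable (?Fl (Suc k))"
      using measurable_from_subalg[OF subalgebra_history_Suc that] by (auto intro: measurable_history)
    have "(\<lambda>\<omega>. \<Phi>' (h k \<omega>) (\<xi>s k \<omega>)) \<in> borel_measurable (?Fl (Suc k))" by measurable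
    then show ?thesis by (subst measurable_cong[of _ _ "\<lambda>\<omega>. \<Phi>' (h k \<omega>) (\<xi>s k \<omega>)"]) (auto simp: Q_eq)
  qed
  have adapted: "u k \<in> borel_measurable (?Fl k) \<and> h k \<in> borel_measurable (?Fl k)" for k
  proof (induction k)
    case 0
    have "u 0 \<in> borel_measurable (?Fl 0) \<longleftrightarrow> (\<lambda>_. u0) \<in> borel_measurable (?Fl 0)"
      by (rule measurable_cong) (use path in simp)
    moreover have "h 0 \<in> borel_measurable (?Fl 0) \<longleftrightarrow> (\<lambda>_. h0) \<in> borel_measurable (?Fl 0)"
      by (rule measurable_cong) (use path in simp)
    ultimately show ?case by simp
  next
    case (Suc k)
    have [measurable]: "u k \<in> borel_measurable (?Fl (Suc k))" "Q k \<in> borel_measurable (?Fl (Suc k))"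
      using measurable_from_subalg[OF subalgebra_history_Suc] Suc Q_step by blast+
    have u [measurable]: "u (Suc k) \<in> borel_measurable (?Fl (Suc k))"
      by (subst measurable_cong[of _ _ "\<lambda>\<omega>. closest_point U (u k \<omega> - \<alpha> k *\<^sub>R Q k \<omega>)"])
        (auto simp: u_Suc)
    have "h (Suc k) \<in> borel_measurable (?Fl (Suc k))"
      by (subst measurable_cong[of _ _ "\<lambda>\<omega>. closest_point U (u (Suc k) \<omega> - \<alpha> (Suc k) *\<^sub>R Q k \<omega>)"])
        (auto simp: h_Suc)
    with u show ?case by simp
  qed
  have Fh_adapted: "(\<lambda>\<omega>. F (h k \<omega>)) \<in> borel_measurable (?Fl k)" for k
  proof -
    have [measurable]: "h k \<in> borel_measurable (?Fl k)" using adapted by simp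
    show ?thesis by (subst measurable_cong[of _ _ "\<lambda>\<omega>. F' (h k \<omega>)"]) (auto simp: F_eq')
  qed
  have unbiased': "(\<integral>\<omega>. (Q k \<omega> - F (h k \<omega>)) \<bullet> Z \<omega> \<partial>M) = 0"
    if Z [measurable]: "Z \<in> borel_measurable (?Fl k)"
      and int: "integrable M (\<lambda>\<omega>. (Q k \<omega> - F (h k \<omega>)) \<bullet> Z \<omega>)" for k Z
  proof -
    define f where "f = (\<lambda>(\<omega>, x). (\<Phi>' (h k \<omega>) x - F' (h k \<omega>)) \<bullet> Z \<omega>)"
    have [measurable]: "h k \<in> borel_measurable (?Fl k)" using adapted by simp
    have f_eq: "f (\<omega>, \<xi>s k \<omega>) = (Q k \<omega> - F (h k \<omega>)) \<bullet> Z \<omega>" if "\<omega> \<in> space M" for \<omega>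
      by (simp add: f_def Q_eq F_eq' that)
    have "(\<integral>\<omega>. f (\<omega>, \<xi>s k \<omega>) \<partial>M) = 0"
    proof (rule integral_indep_eq_0)
      have sub: "subalgebra M (?Fl k)" by (rule subalgebra_history) measurable
      show "(\<lambda>\<omega>. \<omega>) \<in> measurable M (?Fl k)"
        by (rule measurable_from_subalg[OF sub]) simp
      show "\<xi>s k \<in> borel_measurable M" by measurable
      show "prob ((\<lambda>\<omega>. \<omega>) -` A \<inter> (\<xi>s k -` B \<inter> space M))
          = prob ((\<lambda>\<omega>. \<omega>) -` A \<inter> space M) * prob (\<xi>s k -` B \<inter> space M)"
        if "A \<in> sets (?Fl k)" "B \<in> sets borel" for A B
        using indep_history[OF samples_indep that] sets.sets_into_space[OF that(1)]
        by (simp add: Int_absorb2)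
      show "f \<in> borel_measurable (?Fl k \<Otimes>\<^sub>M borel)"
        unfolding f_def by measurable
      show "integrable M (\<lambda>\<omega>. f (\<omega>, \<xi>s k \<omega>))"
        by (rule Bochner_Integration.integrable_cong[THEN iffD1, OF refl _ int]) (simp add: f_eq)
      fix \<omega> assume "\<omega> \<in> space (?Fl k)"
      \<comment> \<open>With the past frozen, the inner integral is the mean of
        \<open>\<Phi>' v\<close> at \<open>\<xi>\<close> minus \<open>F' v\<close> for the fixed
        \<open>v = h k \<omega>\<close>, paired with a fixed vector; it vanishes because
        \<open>F' v\<close> is that mean.\<close>
      have "(\<integral>x. f (\<omega>, x) \<partial>distr M borel (\<xi>s k)) = (\<integral>\<omega>'. (\<Phi>' (h k \<omega>) (\<xi> \<omega>') - F' (h k \<omega>)) \<bullet> Z \<omega> \<partial>M)"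
        unfolding samples_distr using \<xi>_meas by (subst integral_distr) (auto simp: f_def)
      also have "\<dots> = (\<integral>\<omega>'. \<Phi>' (h k \<omega>) (\<xi> \<omega>') - F' (h k \<omega>) \<partial>M) \<bullet> Z \<omega>"
        using F'_int[of "h k \<omega>"] by (intro integral_inner_left) (auto simp: has_bochner_integral_iff)
      also have "\<dots> = 0"
        using F'_int[of "h k \<omega>"] by (simp add: has_bochner_integral_iff prob_space)
      finally show "(\<integral>x. f (\<omega>, x) \<partial>distr M borel (\<xi>s k)) = 0" .
    qed
    then show ?thesis by (simp add: f_eq cong: Bochner_Integration.integral_cong)
  qed
  interpret P: stochastic_popov M ?Fl U ?S F Q u h u0 h0 \<alpha> \<sigma> C D p \<mu>
  proof
    show "subalgebra M (?Fl k)" for k by (rule subalgebra_history) measurable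
    show "subalgebra (?Fl (Suc k)) (?Fl k)" for k by (rule subalgebra_history_Suc)
    show "u k \<in> borel_measurable (?Fl k)" "h k \<in> borel_measurable (?Fl k)" for k
      using adapted by auto
    show "Q k \<in> borel_measurable (?Fl (Suc k))" for k using adapted Q_step by blast
    show "?S \<subseteq> U" by (auto simp: vi_solutions_def)
    show "u 0 \<omega> = u0" "h 0 \<omega> = h0" if "\<omega> \<in> space M" for \<omega> using path[OF that] by auto
    show "\<mu> * infdist v ?S powr p \<le> F v \<bullet> (v - y)" if "v \<in> U" "y \<in> ?S" for v y
      using sharp(3) that by (auto simp: quasi_sharp_def)
    fix k and f :: "real ^ 'm \<Rightarrow> ennreal"
    assume f: "f \<in> borel_measurable borel"
    have sub: "subalgebra M (?Fl k)" for k by (rule subalgebra_history) measurable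
    have [measurable]: "h k \<in> borel_measurable M" "Q k \<in> borel_measurable M"
      "(\<lambda>\<omega>. F (h k \<omega>)) \<in> borel_measurable M"
      using measurable_from_subalg[OF sub] adapted Fh_adapted Q_step by blast+
    show "(\<integral>\<^sup>+\<omega>. f (h k \<omega>) * ennreal ((norm (Q k \<omega> - F (h k \<omega>)))\<^sup>2) \<partial>M)
        \<le> ennreal (\<sigma>\<^sup>2) * (\<integral>\<^sup>+\<omega>. f (h k \<omega>) \<partial>M)"
    proof (rule nn_cond_exp_le_integral[OF _ _ f])
      show "AE \<omega> in M. nn_cond_exp M (sigma_of M (h k))
          (\<lambda>\<omega>. ennreal ((norm (Q k \<omega> - F (h k \<omega>)))\<^sup>2)) \<omega> \<le> ennreal (\<sigma>\<^sup>2)"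
        unfolding Q_def by (rule variance)
    qed measurable
  qed (fact U sol init u_Suc h_Suc unbiased' Fh_adapted growth sharp steps)+
  have AE_sol: "AE \<omega> in M. P.ubar \<omega> \<in> ?S"
    using P.AE_tendsto_ubar by eventually_elim simp
  have [measurable]: "?S \<in> sets borel" using sol(2) by (rule borel_closed)
  have "{\<omega> \<in> space M. P.ubar \<omega> \<in> ?S} \<in> sets M" by measurable
  then have "measure M {\<omega> \<in> space M. P.ubar \<omega> \<in> ?S} = 1"
    using AE_sol by (simp add: prob_Collect_eq_1)
  moreover have "AE \<omega> in M. (\<lambda>k. u k \<omega>) \<longlonglongrightarrow> P.ubar \<omega>" "AE \<omega> in M. (\<lambda>k. h k \<omega>) \<longlonglongrightarrow> P.ubar \<omega>"
    using P.AE_tendsto_ubar by (eventually_elim, simp)+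
  ultimately show ?thesis
    using P.ubar_measurable P.ubar_in P.u_error_integrable P.h_error_integrable
      P.u_error_tendsto P.h_error_tendsto P.iterates_sq P.second_moments_bounded
    by (intro conjI bexI[of _ P.ubar]) blast+
qed

end
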